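(* Suppose that $P$ is a unital semigroup such that $P$ and the opposite semigroup $P^{\mathrm{o}}$ are both left LCM. Let $(B_P\times_\tau^{\mathrm{piso}}P,i_{B_P},i_P)$ be the partial-isometric crossed product of the system $(B_P,P,\tau)$. Then the map $$i_P:P\to B_P\times_\tau^{\mathrm{piso}}P$$ is a bicovariant partial-isometric representation of $P$ whose range generates the $C^*$-algebra $B_P\times_\tau^{\mathrm{piso}}P$. Moreover, for every bicovariant partial-isometric representation $V$ of $P$, there is a (unital) representation $V_*$ of $B_P\times_\tau^{\mathrm{piso}}P$ such that $V_*\circ i_P=V$.
   Context: **Semigroups.** A unital discrete semigroup $P$ (identity $e$) is *left LCM* if it is right cancellative and for all $x,y\in P$ either $Px\cap Py=\emptyset$ or $Px\cap Py=Pz$ for some $z\in P$. $P^{\mathrm{o}}$ is the opposite semigroup, with product $x\bullet y=yx$. **The system $(B_P,P,\tau)$.** For $y\in P$ let $1_y\in\ell^\infty(P)$ be the characteristic function of $yP=\{yx:x\in P\}$. $B_P$ is the $C^*$-subalgebra of $\ell^\infty(P)$ generated by $\{1_y:y\in P\}$; it equals $\overline{\mathrm{span}}\{1_y:y\in P\}$ and has unit $1_e$. The action $\tau:P\to\mathrm{End}(B_P)$ is induced by the shift on $\ell^\infty(P)$: $\tau_x(f)(t)=f(r)$ if $t=xr$ for some $r\in P$ and $\tau_x(f)(t)=0$ otherwise; thus $\tau_x(1_y)=1_{xy}$. **Representations of $P$.** A partial-isometric representation of $P$ on a Hilbert space $H$ is a unital semigroup homomorphism $V:P\to B(H)$ with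 each $V_x$ a partial isometry. It is a *Nica partial-isometric representation* if (right Nica covariance) $V_x^*V_xV_y^*V_y=V_z^*V_z$ when $Px\cap Py=Pz$, and $=0$ when $Px\cap Py=\emptyset$. It is *bicovariant* if in addition (left Nica covariance) $V_xV_x^*V_yV_y^*=V_zV_z^*$ when $xP\cap yP=zP$, and $=0$ when $xP\cap yP=\emptyset$. Likewise for representations in a $C^*$-algebra or its multiplier algebra. **Dynamical systems and crossed products.** $(A,P,\alpha)$ consists of a $C^*$-algebra $A$ and a semigroup homomorphism $\alpha:P\to\mathrm{End}(A)$ with $\alpha_e=\mathrm{id}_A$, each $\alpha_x$ extending to a strictly continuous endomorphism of $\mathcal{M}(A)$. A covariant partial-isometric representation on $H$ is a pair $(\pi,V)$ of a nondegenerate representation $\pi:A\to B(H)$ and a Nica partial-isometric representation $V$ such that $\pi(\alpha_x(a))=V_x\pi(a)V_x^*$ and $V_x^*V_x\pi(a)=\pi(a)V_x^*V_x$ for all $a\in A$, $x\in P$ (similarly for pairs in a $C^*$-algebra). A partial-isometric crossed product of $(A,P,\alpha)$ is a triple $(B,i_A,i_P)$ consisting of a $C^*$-algebra $B$, a nondegenerate injective homomorphism $i_A:A\to B$ and a Nica partial-isometric representation $i_P:P\to\mathcal{M}(B)$ such that: (i) $(i_A,i_P)$ is a covariant partial-isometric representation of $(A,P,\alpha)$ in $B$; (ii) for every covariant partial-isometric representation $(\pi,V)$ on a Hilbert space $H$ there is a nondegenerate representation $\pi\times V:B\to B(H)$ with $(\pi\times V)\circ i_A=\pi$ and $\overline{\pi\times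 V}\circ i_P=V$ (bar = extension to $\mathcal{M}(B)$); (iii) $B$ is generated by $\{i_A(a)i_P(x):a\in A,x\in P\}$. It exists and is unique up to isomorphism; $B$ is denoted $A\times_\alpha^{\mathrm{piso}}P$. (Here $B_P\times_\tau^{\mathrm{piso}}P$ is unital since $B_P$ is, so it equals its multiplier algebra.) *)

theory Defs
  imports "HOL-Analysis.Analysis" "HOL.Hull"
begin

section \<open>Complex vector spaces, unital C*-algebras, Hilbert spaces\<close>

class complex_vect = real_vector +
  fixes scaleC :: "complex \<Rightarrow> 'a \<Rightarrow> 'a"  (infixr "\<cdot>\<^sub>C" 75)
  assumes scaleC_add_right: "c \<cdot>\<^sub>C (x + y) = c \<cdot>\<^sub>C x + c \<cdot>\<^sub>C y"
    and scaleC_add_left: "(c + d) \<cdot>\<^sub>C x = c \<cdot>\<^sub>C x + d \<cdot>\<^sub>C x"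
    and scaleC_scaleC: "c \<cdot>\<^sub>C (d \<cdot>\<^sub>C x) = (c * d) \<cdot>\<^sub>C x"
    and scaleR_eq_scaleC: "r *\<^sub>R x = complex_of_real r \<cdot>\<^sub>C x"

text \<open>Unital C*-algebras. The axiom \<open>0 \<noteq> 1\<close> is deliberately absent, so that
  the bounded operators on the zero Hilbert space are not excluded.\<close>

class unital_cstar_algebra = complex_vect + banach + real_normed_algebra + monoid_mult +
  fixes star :: "'a \<Rightarrow> 'a"  ("(_\<^sup>\<star>)" [1000] 999)
  assumes norm_scaleC: "norm (c \<cdot>\<^sub>C x) = cmod c * norm x"
    and scaleC_mult_left: "(c \<cdot>\<^sub>C x) * y = c \<cdot>\<^sub>C (x * y)"
    and scaleC_mult_right: "x * (c \<cdot>\<^sub>C y) = c \<cdot>\<^sub>C (x * y)"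
    and star_star: "(x\<^sup>\<star>)\<^sup>\<star> = x"
    and star_add: "(x + y)\<^sup>\<star> = x\<^sup>\<star> + y\<^sup>\<star>"
    and star_scaleC: "(c \<cdot>\<^sub>C x)\<^sup>\<star> = cnj c \<cdot>\<^sub>C x\<^sup>\<star>"
    and star_mult: "(x * y)\<^sup>\<star> = y\<^sup>\<star> * x\<^sup>\<star>"
    and cstar_identity: "norm (x\<^sup>\<star> * x) = (norm x)\<^sup>2"

text \<open>Complex Hilbert spaces, with inner product linear in the first variable. The
  norm is tied to the complex inner product through its real part, which is the real inner
  product of the library.\<close>

class complex_hilbert = complex_vect + banach + real_inner +
  fixes cinner :: "'a \<Rightarrow> 'a \<Rightarrow> complex"
  assumes cinner_commute: "cinner x y = cnj (cinner y x)"
    and cinner_add_left: "cinner (x + y) z = cinner x z + cinner y z"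
    and cinner_scaleC_left: "cinner (c \<cdot>\<^sub>C x) y = c * cinner x y"
    and inner_eq_Re_cinner: "inner x y = Re (cinner x y)"

lemma scaleC_one [simp]: "1 \<cdot>\<^sub>C (x :: 'a :: complex_vect) = x"
  using scaleR_eq_scaleC[of 1 x] by simp

lemma scaleC_minus_one: "(-1) \<cdot>\<^sub>C (x :: 'a :: complex_vect) = - x"
  using scaleR_eq_scaleC[of "-1" x] by simp

lemma cinner_add_right:
  "cinner x (y + z) = cinner x y + cinner x (z :: 'a :: complex_hilbert)"
  by (metis cinner_commute cinner_add_left complex_cnj_add)

lemma cinner_scaleC_right: "cinner x (c \<cdot>\<^sub>C y) = cnj c * cinner x (y :: 'a :: complex_hilbert)"
  by (metis cinner_commute cinner_scaleC_left complex_cnj_mult)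

lemma cinner_eq: "cinner x y = Complex (inner x y) (inner x (\<i> \<cdot>\<^sub>C (y :: 'a :: complex_hilbert)))"
  by (simp add: complex_eq_iff inner_eq_Re_cinner cinner_scaleC_right)

lemma inner_scaleC_shift:
  "inner (c \<cdot>\<^sub>C x) y = inner x (cnj c \<cdot>\<^sub>C (y :: 'a :: complex_hilbert))"
  by (simp add: inner_eq_Re_cinner cinner_scaleC_right cinner_scaleC_left)

lemma norm_scaleC_hilbert: "norm (c \<cdot>\<^sub>C x) = cmod c * norm (x :: 'a :: complex_hilbert)"
proof -
  have "inner (c \<cdot>\<^sub>C x) (c \<cdot>\<^sub>C x) = inner x ((cnj c * c) \<cdot>\<^sub>C x)"
    by (simp add: inner_scaleC_shift scaleC_scaleC)
  also have "cnj c * c = complex_of_real ((cmod c)\<^sup>2)"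
    by (metis complex_norm_square mult.commute)
  also have "inner x (complex_of_real ((cmod c)\<^sup>2) \<cdot>\<^sub>C x) = (cmod c)\<^sup>2 * inner x x"
    by (metis inner_scaleR_right scaleR_eq_scaleC)
  finally have "(norm (c \<cdot>\<^sub>C x))\<^sup>2 = (cmod c * norm x)\<^sup>2"
    by (simp add: dot_square_norm power_mult_distrib)
  then show ?thesis
    by (simp add: power2_eq_iff_nonneg)
qed


section \<open>Bounded operators on a Hilbert space\<close>

lemma riesz_representation_real:
  fixes f :: "'a :: {banach, real_inner} \<Rightarrow> real"
  assumes f: "bounded_linear f"
  shows "\<exists>z. \<forall>x. f x = inner x z"
proof -
  interpret f: bounded_linear f by fact
  define J where "J x = (norm x)\<^sup>2 - 2 * f x" for x
  obtain K where K: "\<And>x. \<bar>f x\<bar> \<le> norm x * K"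
    using f.bounded by auto
  have J_ge: "- (K\<^sup>2) \<le> J x" for x
  proof -
    have "0 \<le> (norm x - K)\<^sup>2" by simp
    then show ?thesis
      using K[of x] by (simp add: J_def power2_diff)
  qed
  define m where "m = Inf (range J)"
  have bdd: "bdd_below (range J)"
    using J_ge by (auto intro!: bdd_belowI)
  have m_le: "m \<le> J x" for x
    unfolding m_def by (rule cInf_lower[OF _ bdd]) auto
  have "\<exists>x. J x < m + inverse (real (Suc n))" for n
  proof -
    have "\<exists>v\<in>range J. v < m + inverse (real (Suc n))"
      unfolding m_def
      by (subst cInf_less_iff[OF _ bdd, symmetric]) auto
    then show ?thesis by auto
  qed
  then obtain X where X: "\<And>n. J (X n) < m + inverse (real (Suc n))"
    by metis
  have par: "(norm (x - y))\<^sup>2 \<le> 2 * (J x - m) + 2 * (J y - m)" for x y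
  proof -
    have "(norm (x - y))\<^sup>2 = 2 * J x + 2 * J y - 4 * J ((1/2) *\<^sub>R (x + y))"
      by (simp add: J_def power2_norm_eq_inner f.scaleR f.add inner_simps inner_commute
          algebra_simps)
    then show ?thesis
      using m_le[of "(1/2) *\<^sub>R (x + y)"] by simp
  qed
  have "Cauchy X"
  proof (rule CauchyI)
    fix e :: real assume e: "e > 0"
    obtain N where N: "inverse (real (Suc N)) < e\<^sup>2 / 4"
      using reals_Archimedean[of "e\<^sup>2 / 4"] e by auto
    show "\<exists>M. \<forall>i\<ge>M. \<forall>n\<ge>M. norm (X i - X n) < e"
    proof (intro exI allI impI)
      fix i n assume i: "N \<le> i" and n: "N \<le> n"
      have le: "inverse (real (Suc k)) \<le> inverse (real (Suc N))" if "N \<le> k" for k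
        using that by (auto simp: le_imp_inverse_le)
      have "J (X i) - m < e\<^sup>2 / 4" "J (X n) - m < e\<^sup>2 / 4"
        using order_less_le_trans[OF X[of i] add_left_mono[OF le[OF i]]]
          order_less_le_trans[OF X[of n] add_left_mono[OF le[OF n]]] N by auto
      then have "(norm (X i - X n))\<^sup>2 < e\<^sup>2"
        using order_le_less_trans[OF par[of "X i" "X n"]] by (simp add: field_simps)
      then show "norm (X i - X n) < e"
        using e by (simp add: power2_less_imp_less)
    qed
  qed
  then obtain z where z: "X \<longlonglongrightarrow> z"
    using Cauchy_convergent convergent_def by blast
  have "(\<lambda>n. J (X n)) \<longlonglongrightarrow> J z"
    unfolding J_def by (intro tendsto_intros z f.tendsto)
  moreover have "(\<lambda>n. m + inverse (real (Suc n))) \<longlonglongrightarrow> m + 0"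
    by (intro tendsto_intros LIMSEQ_inverse_real_of_nat)
  ultimately have Jz: "J z \<le> m"
    using X by (intro LIMSEQ_le[of "\<lambda>n. J (X n)" "J z" "\<lambda>n. m + inverse (real (Suc n))"])
      (auto intro!: exI[of _ 0] less_imp_le)
  have "f h = inner h z" for h
  proof (rule ccontr)
    define d where "d = inner h z - f h"
    assume "f h \<noteq> inner h z"
    then have d: "d \<noteq> 0" by (simp add: d_def)
    have h: "h \<noteq> 0"
      using \<open>f h \<noteq> inner h z\<close> f.zero by auto
    have "J (z + t *\<^sub>R h) = J z + (t\<^sup>2 * (norm h)\<^sup>2 + 2 * t * d)" for t
      by (simp add: J_def d_def power2_norm_eq_inner f.scaleR f.add inner_simps inner_commute[of z h]
          algebra_simps) (simp add: power2_eq_square)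
    then have pos: "0 \<le> t\<^sup>2 * (norm h)\<^sup>2 + 2 * t * d" for t
      using m_le[of "z + t *\<^sub>R h"] Jz by simp
    have "(- d / (norm h)\<^sup>2)\<^sup>2 * (norm h)\<^sup>2 + 2 * (- d / (norm h)\<^sup>2) * d = - d\<^sup>2 / (norm h)\<^sup>2"
      using h by (simp add: field_simps power2_eq_square)
    moreover have "- d\<^sup>2 / (norm h)\<^sup>2 < 0"
      using h d by (simp add: divide_neg_pos)
    ultimately show False
      using pos[of "- d / (norm h)\<^sup>2"] by simp
  qed
  then show ?thesis by blast
qed

definition bounded_clinear :: "('a :: complex_hilbert \<Rightarrow> 'a) \<Rightarrow> bool" where
  "bounded_clinear T \<longleftrightarrow> bounded_linear T \<and> (\<forall>c x. T (c \<cdot>\<^sub>C x) = c \<cdot>\<^sub>C T x)"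

definition cadjoint :: "('a :: complex_hilbert \<Rightarrow> 'a) \<Rightarrow> 'a \<Rightarrow> 'a" where
  "cadjoint T = (THE S. \<forall>x y. cinner (T x) y = cinner x (S y))"

lemma cinner_eqI: "(\<And>x. cinner x y = cinner x z) \<Longrightarrow> y = (z :: 'a :: complex_hilbert)"
  using inner_eq_zero_iff[of "y - z"]
  by (simp only: inner_diff_right) (simp only: inner_eq_Re_cinner, simp)

lemma cadjoint_unique:
  assumes "\<And>x y. cinner (T x) y = cinner x (S y)"
  shows "cadjoint T = (S :: 'a :: complex_hilbert \<Rightarrow> 'a)"
  unfolding cadjoint_def
proof (rule the_equality)
  show "\<forall>x y. cinner (T x) y = cinner x (S y)" using assms by simp
next
  fix R assume R: "\<forall>x y. cinner (T x) y = cinner x (R y)"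
  show "R = S"
  proof
    fix y show "R y = S y"
      by (rule cinner_eqI) (metis R assms)
  qed
qed

lemma cadjoint_works:
  assumes T: "bounded_clinear (T :: 'a :: complex_hilbert \<Rightarrow> 'a)"
  shows "cinner (T x) y = cinner x (cadjoint T y)"
proof -
  interpret T: bounded_linear T using T by (simp add: bounded_clinear_def)
  have Tc: "T (c \<cdot>\<^sub>C x) = c \<cdot>\<^sub>C T x" for c x using T by (simp add: bounded_clinear_def)
  have "\<exists>z. \<forall>x. inner (T x) y = inner x z" for y
    by (rule riesz_representation_real)
      (rule bounded_linear_compose[OF bounded_linear_inner_left T.bounded_linear_axioms])
  then obtain S where S: "\<And>x y. inner (T x) y = inner x (S y)"
    by metis
  have "inner x (S (\<i> \<cdot>\<^sub>C y)) = inner x (\<i> \<cdot>\<^sub>C S y)" for x y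
  proof -
    have "inner x (S (\<i> \<cdot>\<^sub>C y)) = inner (cnj \<i> \<cdot>\<^sub>C T x) y"
      by (metis S inner_scaleC_shift complex_cnj_cnj)
    also have "\<dots> = inner (cnj \<i> \<cdot>\<^sub>C x) (S y)"
      by (metis S Tc)
    also have "\<dots> = inner x (\<i> \<cdot>\<^sub>C S y)"
      by (metis inner_scaleC_shift complex_cnj_cnj)
    finally show ?thesis .
  qed
  then have "cinner (T x) y = cinner x (S y)" for x y
    by (simp add: cinner_eq S)
  with cadjoint_unique[of T S] show ?thesis by simp
qed

lemma cadjoint_norm_le:
  assumes T: "bounded_clinear (T :: 'a :: complex_hilbert \<Rightarrow> 'a)"
  shows "norm (cadjoint T y) \<le> onorm T * norm y"
proof -
  have bl: "bounded_linear T" using T by (simp add: bounded_clinear_def)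
  let ?S = "cadjoint T"
  have "(norm (?S y))\<^sup>2 = inner (T (?S y)) y"
    by (simp add: power2_norm_eq_inner inner_eq_Re_cinner cadjoint_works[OF T])
  also have "\<dots> \<le> norm (T (?S y)) * norm y"
    by (rule norm_cauchy_schwarz)
  also have "\<dots> \<le> (onorm T * norm (?S y)) * norm y"
    by (intro mult_right_mono onorm[OF bl]) simp
  finally have "norm (?S y) * norm (?S y) \<le> norm (?S y) * (onorm T * norm y)"
    by (simp add: power2_eq_square algebra_simps)
  moreover have "0 \<le> onorm T * norm y"
    using onorm_pos_le[OF bl] by simp
  ultimately show ?thesis
    by (cases "?S y = 0") (simp_all only: norm_zero mult_le_cancel_left_pos zero_less_norm_iff
        not_False_eq_True)
qed

lemma bounded_clinear_cadjoint:
  assumes T: "bounded_clinear (T :: 'a :: complex_hilbert \<Rightarrow> 'a)"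
  shows "bounded_clinear (cadjoint T)"
proof -
  have add: "cadjoint T (x + y) = cadjoint T x + cadjoint T y" for x y
    by (rule cinner_eqI) (simp only: cadjoint_works[OF T, symmetric] cinner_add_right)
  have sc: "cadjoint T (c \<cdot>\<^sub>C x) = c \<cdot>\<^sub>C cadjoint T x" for c x
    by (rule cinner_eqI) (simp only: cadjoint_works[OF T, symmetric] cinner_scaleC_right)
  have "bounded_linear (cadjoint T)"
  proof (rule bounded_linear_intro[of _ "onorm T"])
    show "cadjoint T (r *\<^sub>R x) = r *\<^sub>R cadjoint T x" for r x
      unfolding scaleR_eq_scaleC by (rule sc)
    show "norm (cadjoint T x) \<le> norm x * onorm T" for x
      using cadjoint_norm_le[OF T, of x] by (simp only: mult.commute)
  qed (rule add)
  with sc show ?thesis by (simp add: bounded_clinear_def)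
qed

typedef (overloaded) 'h bop = "{T :: 'h :: complex_hilbert \<Rightarrow> 'h. bounded_clinear T}"
  morphisms bop_apply Bop
  by (rule exI[of _ "\<lambda>x. x"]) (simp add: bounded_clinear_def)

setup_lifting type_definition_bop

lemma bop_eqI: "(\<And>x. bop_apply S x = bop_apply T x) \<Longrightarrow> S = T"
  by (metis bop_apply_inject ext)

lemma bop_clinear: "bounded_clinear (bop_apply T)"
  using bop_apply by blast

lemma bop_linear: "bounded_linear (bop_apply T)"
  using bop_clinear[of T] by (simp add: bounded_clinear_def)

lemma scaleR_hilbert_commute: "c \<cdot>\<^sub>C r *\<^sub>R x = r *\<^sub>R c \<cdot>\<^sub>C (x :: 'a :: complex_hilbert)"
  by (simp add: scaleR_eq_scaleC scaleC_scaleC mult.commute)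

lemma bounded_linear_scaleC: "bounded_linear (\<lambda>x :: 'a :: complex_hilbert. c \<cdot>\<^sub>C x)"
  by (rule bounded_linear_intro[of _ "cmod c"])
    (auto simp: scaleC_add_right scaleR_hilbert_commute norm_scaleC_hilbert mult.commute)

instantiation bop :: (complex_hilbert) "{complex_vect, real_normed_algebra, monoid_mult}"
begin

lift_definition zero_bop :: "'a bop" is "\<lambda>_. 0"
  using scaleC_add_right[of _ "0::'a" 0] by (simp add: bounded_clinear_def bounded_linear_zero)

lift_definition one_bop :: "'a bop" is "\<lambda>x. x"
  by (simp add: bounded_clinear_def)

lift_definition plus_bop :: "'a bop \<Rightarrow> 'a bop \<Rightarrow> 'a bop" is "\<lambda>S T x. S x + T x"
  by (simp add: bounded_clinear_def bounded_linear_add scaleC_add_right)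

lift_definition scaleC_bop :: "complex \<Rightarrow> 'a bop \<Rightarrow> 'a bop" is "\<lambda>c T x. c \<cdot>\<^sub>C T x"
  by (auto simp: bounded_clinear_def scaleC_scaleC mult.commute
      intro: bounded_linear_compose[OF bounded_linear_scaleC])

lift_definition uminus_bop :: "'a bop \<Rightarrow> 'a bop" is "\<lambda>T x. - T x"
  by (auto simp: bounded_clinear_def bounded_linear_minus)
    (simp add: scaleC_minus_one[symmetric] scaleC_scaleC)

definition minus_bop :: "'a bop \<Rightarrow> 'a bop \<Rightarrow> 'a bop" where
  "minus_bop S T = S + (- T)"

definition scaleR_bop :: "real \<Rightarrow> 'a bop \<Rightarrow> 'a bop" where
  "scaleR_bop r T = complex_of_real r \<cdot>\<^sub>C T"

lift_definition times_bop :: "'a bop \<Rightarrow> 'a bop \<Rightarrow> 'a bop" is "\<lambda>S T x. S (T x)"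
  by (auto simp: bounded_clinear_def intro: bounded_linear_compose)

lift_definition norm_bop :: "'a bop \<Rightarrow> real" is onorm .

definition sgn_bop :: "'a bop \<Rightarrow> 'a bop" where
  "sgn_bop T = inverse (norm T) *\<^sub>R T"

definition dist_bop :: "'a bop \<Rightarrow> 'a bop \<Rightarrow> real" where
  "dist_bop S T = norm (S - T)"

definition uniformity_bop :: "('a bop \<times> 'a bop) filter" where
  "uniformity_bop = (INF e\<in>{0 <..}. principal {(x, y). dist x y < e})"

definition open_bop :: "'a bop set \<Rightarrow> bool" where
  "open_bop U = (\<forall>x\<in>U. \<forall>\<^sub>F (x', y) in uniformity. x' = x \<longrightarrow> y \<in> U)"

lemma bop_apply_minus: "bop_apply (S - T) x = bop_apply S x - bop_apply T x"
  by (simp add: minus_bop_def plus_bop.rep_eq uminus_bop.rep_eq)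

lemma bop_apply_scaleR: "bop_apply (r *\<^sub>R T) x = r *\<^sub>R bop_apply T x"
  by (simp add: scaleR_bop_def scaleC_bop.rep_eq scaleR_eq_scaleC)

lemma bop_norm_le: "norm (bop_apply T x) \<le> norm T * norm x"
  by (simp add: norm_bop.rep_eq onorm bop_linear)

lemma bop_normI: "0 \<le> b \<Longrightarrow> (\<And>x. norm (bop_apply T x) \<le> b * norm x) \<Longrightarrow> norm T \<le> b"
  unfolding norm_bop.rep_eq by (rule onorm_bound)

lemma bop_norm_pos: "0 \<le> norm (T :: 'a bop)"
  by (simp add: norm_bop.rep_eq onorm_pos_le bop_linear)

instance
proof
  fix S T U :: "'a bop" and r s :: real and c d :: complex
  interpret S: bounded_linear "bop_apply S" by (rule bop_linear)
  interpret T: bounded_linear "bop_apply T" by (rule bop_linear)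
  note app = plus_bop.rep_eq uminus_bop.rep_eq bop_apply_minus zero_bop.rep_eq one_bop.rep_eq
    times_bop.rep_eq scaleC_bop.rep_eq bop_apply_scaleR
  show "S + T + U = S + (T + U)" "S + T = T + S" "0 + S = S" "- S + S = 0" "S - T = S + - T"
    by (rule bop_eqI; simp add: app algebra_simps)+
  show "r *\<^sub>R (S + T) = r *\<^sub>R S + r *\<^sub>R T" "(r + s) *\<^sub>R S = r *\<^sub>R S + s *\<^sub>R S"
    "r *\<^sub>R s *\<^sub>R S = (r * s) *\<^sub>R S" "1 *\<^sub>R S = S"
    by (rule bop_eqI; simp add: app algebra_simps)+
  show "c \<cdot>\<^sub>C (S + T) = c \<cdot>\<^sub>C S + c \<cdot>\<^sub>C T" "(c + d) \<cdot>\<^sub>C S = c \<cdot>\<^sub>C S + d \<cdot>\<^sub>C S"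
    "c \<cdot>\<^sub>C d \<cdot>\<^sub>C S = (c * d) \<cdot>\<^sub>C S"
    by (rule bop_eqI; simp add: app scaleC_add_right scaleC_add_left scaleC_scaleC)+
  show "r *\<^sub>R S = complex_of_real r \<cdot>\<^sub>C S"
    by (simp add: scaleR_bop_def)
  show "S * T * U = S * (T * U)" "(S + T) * U = S * U + T * U" "1 * S = S" "S * 1 = S"
    by (rule bop_eqI; simp add: app)+
  show "S * (T + U) = S * T + S * U" "(r *\<^sub>R S) * T = r *\<^sub>R (S * T)"
    "S * (r *\<^sub>R T) = r *\<^sub>R (S * T)"
    by (rule bop_eqI; simp add: app S.add S.scaleR)+
  show "dist S T = norm (S - T)" by (simp add: dist_bop_def)
  show "sgn S = inverse (norm S) *\<^sub>R S" by (simp add: sgn_bop_def)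
  show "uniformity = (INF e\<in>{0 <..}. principal {(x, y). dist x (y :: 'a bop) < e})"
    by (simp add: uniformity_bop_def)
  show "open V = (\<forall>x\<in>V. \<forall>\<^sub>F (x', y) in uniformity. x' = x \<longrightarrow> y \<in> V)" for V :: "'a bop set"
    by (simp add: open_bop_def)
  show "(norm S = 0) = (S = 0)"
    by (auto simp: norm_bop.rep_eq onorm_eq_0 bop_linear zero_bop.rep_eq intro!: bop_eqI)
  show "norm (S + T) \<le> norm S + norm T"
    by (simp add: norm_bop.rep_eq plus_bop.rep_eq onorm_triangle bop_linear)
  show "norm (r *\<^sub>R S) = \<bar>r\<bar> * norm S"
    by (simp add: norm_bop.rep_eq bop_apply_scaleR[abs_def] onorm_scaleR bop_linear)
  show "norm (S * T) \<le> norm S * norm T"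
    using onorm_compose[OF bop_linear[of S] bop_linear[of T]]
    by (simp add: norm_bop.rep_eq times_bop.rep_eq o_def)
qed

end

lemmas bop_apply_simps = plus_bop.rep_eq uminus_bop.rep_eq bop_apply_minus zero_bop.rep_eq
  one_bop.rep_eq times_bop.rep_eq scaleC_bop.rep_eq bop_apply_scaleR

instance bop :: (complex_hilbert) banach
proof
  show "convergent X" if X: "Cauchy X" for X :: "nat \<Rightarrow> 'a bop"
  proof -
    define Y where "Y n = Blinfun (bop_apply (X n))" for n
    have Y: "blinfun_apply (Y n) = bop_apply (X n)" for n
      by (simp add: Y_def bounded_linear_Blinfun_apply bop_linear)
    have nY: "norm (Y i - Z) = onorm (\<lambda>x. bop_apply (X i) x - blinfun_apply Z x)" for i Z
      by (simp add: norm_blinfun.rep_eq minus_blinfun.rep_eq Y)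
    have dX: "dist (X i) (X j) = dist (Y i) (Y j)" for i j
      unfolding dist_bop_def dist_norm nY
      by (simp add: norm_bop.rep_eq bop_apply_minus[abs_def] Y)
    have "Cauchy Y"
      using X by (simp add: Cauchy_def dX)
    then obtain L where L: "Y \<longlonglongrightarrow> L"
      using Cauchy_convergent convergent_def by blast
    have Lx: "(\<lambda>n. bop_apply (X n) x) \<longlonglongrightarrow> blinfun_apply L x" for x
      using blinfun.tendsto[OF L tendsto_const[of x]] by (simp add: Y)
    have "blinfun_apply L (c \<cdot>\<^sub>C x) = c \<cdot>\<^sub>C blinfun_apply L x" for c x
    proof (rule LIMSEQ_unique[OF Lx])
      have "(\<lambda>n. c \<cdot>\<^sub>C bop_apply (X n) x) \<longlonglongrightarrow> c \<cdot>\<^sub>C blinfun_apply L x"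
        by (rule bounded_linear.tendsto[OF bounded_linear_scaleC Lx])
      then show "(\<lambda>n. bop_apply (X n) (c \<cdot>\<^sub>C x)) \<longlonglongrightarrow> c \<cdot>\<^sub>C blinfun_apply L x"
        using bop_clinear[of "X _"] by (simp add: bounded_clinear_def)
    qed
    then have Lc: "bounded_clinear (blinfun_apply L)"
      by (simp add: bounded_clinear_def blinfun.bounded_linear_right)
    define Z where "Z = Bop (blinfun_apply L)"
    have Z: "bop_apply Z = blinfun_apply L"
      using Lc by (simp add: Z_def Bop_inverse)
    have "dist (X i) Z = dist (Y i) L" for i
      unfolding dist_bop_def dist_norm nY
      by (simp add: norm_bop.rep_eq bop_apply_minus[abs_def] Z)
    moreover have "\<forall>e>0. \<exists>n0. \<forall>n\<ge>n0. dist (Y n) L < e"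
      using L by (simp add: lim_sequentially)
    ultimately have "\<forall>e>0. \<exists>n0. \<forall>n\<ge>n0. dist (X n) Z < e" by simp
    then have "X \<longlonglongrightarrow> Z" by (simp add: lim_sequentially)
    then show ?thesis by (rule convergentI)
  qed
qed

instantiation bop :: (complex_hilbert) unital_cstar_algebra
begin

lift_definition star_bop :: "'a bop \<Rightarrow> 'a bop" is cadjoint
  by (rule bounded_clinear_cadjoint)

lemma cinner_star_bop: "cinner (bop_apply T x) y = cinner x (bop_apply (T\<^sup>\<star>) y)"
  by (simp add: star_bop.rep_eq cadjoint_works bop_clinear)

lemma star_bop_unique:
  assumes "\<And>x y. cinner (bop_apply T x) y = cinner x (bop_apply S y)"
  shows "T\<^sup>\<star> = S"
  by (rule bop_eqI) (simp add: star_bop.rep_eq cadjoint_unique[OF assms])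

instance
proof
  fix S T U :: "'a bop" and c d :: complex
  show "(c \<cdot>\<^sub>C S) * T = c \<cdot>\<^sub>C (S * T)"
    by (rule bop_eqI; simp add: bop_apply_simps)
  show "S * (c \<cdot>\<^sub>C T) = c \<cdot>\<^sub>C (S * T)"
    using bop_clinear[of S] by (intro bop_eqI) (simp add: bop_apply_simps bounded_clinear_def)
  show "norm (c \<cdot>\<^sub>C S) = cmod c * norm S"
  proof (cases "c = 0")
    case True
    then have "c \<cdot>\<^sub>C S = 0"
      by (intro bop_eqI) (metis scaleC_bop.rep_eq zero_bop.rep_eq norm_scaleC_hilbert norm_zero
          mult_zero_left norm_eq_zero)
    then show ?thesis using True by (simp add: norm_bop.rep_eq zero_bop.rep_eq onorm_zero)
  next
    case False
    have le: "norm (c \<cdot>\<^sub>C S) \<le> cmod c * norm S" for c and S :: "'a bop"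
    proof (rule bop_normI)
      show "0 \<le> cmod c * norm S" by simp
      fix x
      show "norm (bop_apply (c \<cdot>\<^sub>C S) x) \<le> cmod c * norm S * norm x"
        using mult_left_mono[OF bop_norm_le[of S x], of "cmod c"]
        by (simp add: bop_apply_simps norm_scaleC_hilbert mult.assoc)
    qed
    have "inverse c \<cdot>\<^sub>C c \<cdot>\<^sub>C S = S"
      using False by (intro bop_eqI) (simp add: bop_apply_simps scaleC_scaleC)
    then have "norm S \<le> inverse (cmod c) * norm (c \<cdot>\<^sub>C S)"
      using le[of "inverse c" "c \<cdot>\<^sub>C S"] by (simp add: norm_inverse)
    then have "cmod c * norm S \<le> norm (c \<cdot>\<^sub>C S)"
      using False by (simp add: field_simps)
    with le[of c S] show ?thesis by simp
  qed
  show ss: "(S\<^sup>\<star>)\<^sup>\<star> = S" for S :: "'a bop"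
    by (rule star_bop_unique) (metis cinner_commute cinner_star_bop)
  show "(S + T)\<^sup>\<star> = S\<^sup>\<star> + T\<^sup>\<star>"
    by (rule star_bop_unique)
      (simp add: bop_apply_simps cinner_add_left cinner_add_right cinner_star_bop)
  show "(c \<cdot>\<^sub>C S)\<^sup>\<star> = cnj c \<cdot>\<^sub>C S\<^sup>\<star>"
    by (rule star_bop_unique)
      (simp add: bop_apply_simps cinner_scaleC_left cinner_scaleC_right cinner_star_bop)
  show "(S * T)\<^sup>\<star> = T\<^sup>\<star> * S\<^sup>\<star>"
    by (rule star_bop_unique) (simp add: bop_apply_simps cinner_star_bop)
  show "norm (S\<^sup>\<star> * S) = (norm S)\<^sup>2"
  proof (rule antisym)
    have nstar: "norm (S\<^sup>\<star>) \<le> norm S"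
      by (rule bop_normI)
        (simp_all add: star_bop.rep_eq norm_bop.rep_eq cadjoint_norm_le bop_clinear
          onorm_pos_le bop_linear)
    show "norm (S\<^sup>\<star> * S) \<le> (norm S)\<^sup>2"
      using norm_mult_ineq[of "S\<^sup>\<star>" S] mult_right_mono[OF nstar bop_norm_pos[of S]]
      by (simp add: power2_eq_square)
    have "norm S \<le> sqrt (norm (S\<^sup>\<star> * S))"
    proof (rule bop_normI)
      show "0 \<le> sqrt (norm (S\<^sup>\<star> * S))" by simp
      fix x
      have "(norm (bop_apply S x))\<^sup>2 = inner x (bop_apply (S\<^sup>\<star> * S) x)"
        by (simp add: power2_norm_eq_inner inner_eq_Re_cinner cinner_star_bop bop_apply_simps)
      also have "\<dots> \<le> norm x * norm (bop_apply (S\<^sup>\<star> * S) x)"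
        by (rule norm_cauchy_schwarz)
      also have "\<dots> \<le> norm x * (norm (S\<^sup>\<star> * S) * norm x)"
        by (intro mult_left_mono bop_norm_le) simp
      also have "\<dots> = (sqrt (norm (S\<^sup>\<star> * S)) * norm x)\<^sup>2"
        by (simp add: power_mult_distrib bop_norm_pos power2_eq_square mult_ac)
      finally show "norm (bop_apply S x) \<le> sqrt (norm (S\<^sup>\<star> * S)) * norm x"
        by (rule power2_le_imp_le) (simp add: bop_norm_pos)
    qed
    then show "(norm S)\<^sup>2 \<le> norm (S\<^sup>\<star> * S)"
      by (metis bop_norm_pos power_mono real_sqrt_pow2)
  qed
qed

end


section \<open>The C*-algebra of bounded functions\<close>

typedef 'p linf = "{f :: 'p \<Rightarrow> complex. bounded (range f)}"
  morphisms linf_apply Linf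
  by (rule exI[of _ "\<lambda>_. 0"]) simp

setup_lifting type_definition_linf

lemma linf_eqI: "(\<And>x. linf_apply f x = linf_apply g x) \<Longrightarrow> f = g"
  by (metis linf_apply_inject ext)

lemma bounded_range_iff: "bounded (range f) \<longleftrightarrow> (\<exists>K. \<forall>x. norm (f x) \<le> K)"
  by (auto simp: bounded_iff)

instantiation linf :: (type) "{complex_vect, real_normed_algebra, monoid_mult}"
begin

lift_definition zero_linf :: "'a linf" is "\<lambda>_. 0" by simp

lift_definition one_linf :: "'a linf" is "\<lambda>_. 1" by simp

lift_definition plus_linf :: "'a linf \<Rightarrow> 'a linf \<Rightarrow> 'a linf" is "\<lambda>f g x. f x + g x"
  by (rule bounded_plus_comp)

lift_definition minus_linf :: "'a linf \<Rightarrow> 'a linf \<Rightarrow> 'a linf" is "\<lambda>f g x. f x - g x"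
  by (rule bounded_minus_comp)

lift_definition uminus_linf :: "'a linf \<Rightarrow> 'a linf" is "\<lambda>f x. - f x"
  by (simp add: bounded_range_iff)

lift_definition times_linf :: "'a linf \<Rightarrow> 'a linf \<Rightarrow> 'a linf" is "\<lambda>f g x. f x * g x"
  unfolding bounded_range_iff norm_mult by (meson mult_mono' norm_ge_zero)

lift_definition scaleC_linf :: "complex \<Rightarrow> 'a linf \<Rightarrow> 'a linf" is "\<lambda>c f x. c * f x"
  unfolding bounded_range_iff norm_mult by (meson mult_left_mono norm_ge_zero)

definition scaleR_linf :: "real \<Rightarrow> 'a linf \<Rightarrow> 'a linf" where
  "scaleR_linf r f = complex_of_real r \<cdot>\<^sub>C f"

lift_definition norm_linf :: "'a linf \<Rightarrow> real" is "\<lambda>f. SUP x. cmod (f x)" .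

definition sgn_linf :: "'a linf \<Rightarrow> 'a linf" where
  "sgn_linf f = inverse (norm f) *\<^sub>R f"

definition dist_linf :: "'a linf \<Rightarrow> 'a linf \<Rightarrow> real" where
  "dist_linf f g = norm (f - g)"

definition uniformity_linf :: "('a linf \<times> 'a linf) filter" where
  "uniformity_linf = (INF e\<in>{0 <..}. principal {(x, y). dist x y < e})"

definition open_linf :: "'a linf set \<Rightarrow> bool" where
  "open_linf U = (\<forall>x\<in>U. \<forall>\<^sub>F (x', y) in uniformity. x' = x \<longrightarrow> y \<in> U)"

lemma linf_apply_scaleR: "linf_apply (r *\<^sub>R f) x = complex_of_real r * linf_apply f x"
  by (simp add: scaleR_linf_def scaleC_linf.rep_eq)

lemma linf_le_norm: "cmod (linf_apply f x) \<le> norm f"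
proof -
  have "bdd_above (range (\<lambda>x. cmod (linf_apply f x)))"
    using linf_apply[of f] by (auto simp: bounded_range_iff bdd_above_def)
  then show ?thesis
    unfolding norm_linf.rep_eq by (rule cSUP_upper[OF UNIV_I])
qed

lemma linf_normI: "(\<And>x. cmod (linf_apply f x) \<le> b) \<Longrightarrow> norm f \<le> b"
  unfolding norm_linf.rep_eq by (rule cSUP_least) auto

lemma linf_norm_pos: "0 \<le> norm (f :: 'a linf)"
  using linf_le_norm[of f] norm_ge_zero order_trans by blast

instance
proof
  fix f g h :: "'a linf" and r s :: real and c d :: complex
  note app = plus_linf.rep_eq uminus_linf.rep_eq minus_linf.rep_eq zero_linf.rep_eq
    one_linf.rep_eq times_linf.rep_eq scaleC_linf.rep_eq linf_apply_scaleR
  show "f + g + h = f + (g + h)" "f + g = g + f" "0 + f = f" "- f + f = 0" "f - g = f + - g"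
    "r *\<^sub>R (f + g) = r *\<^sub>R f + r *\<^sub>R g" "(r + s) *\<^sub>R f = r *\<^sub>R f + s *\<^sub>R f"
    "r *\<^sub>R s *\<^sub>R f = (r * s) *\<^sub>R f" "1 *\<^sub>R f = f"
    "c \<cdot>\<^sub>C (f + g) = c \<cdot>\<^sub>C f + c \<cdot>\<^sub>C g" "(c + d) \<cdot>\<^sub>C f = c \<cdot>\<^sub>C f + d \<cdot>\<^sub>C f"
    "c \<cdot>\<^sub>C d \<cdot>\<^sub>C f = (c * d) \<cdot>\<^sub>C f" "r *\<^sub>R f = complex_of_real r \<cdot>\<^sub>C f"
    "f * g * h = f * (g * h)" "(f + g) * h = f * h + g * h" "1 * f = f" "f * 1 = f"
    "f * (g + h) = f * g + f * h" "(r *\<^sub>R f) * g = r *\<^sub>R (f * g)"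
    "f * (r *\<^sub>R g) = r *\<^sub>R (f * g)"
    by (rule linf_eqI; simp add: app algebra_simps)+
  show "dist f g = norm (f - g)" by (simp add: dist_linf_def)
  show "sgn f = inverse (norm f) *\<^sub>R f" by (simp add: sgn_linf_def)
  show "uniformity = (INF e\<in>{0 <..}. principal {(x, y). dist x (y :: 'a linf) < e})"
    by (simp add: uniformity_linf_def)
  show "open V = (\<forall>x\<in>V. \<forall>\<^sub>F (x', y) in uniformity. x' = x \<longrightarrow> y \<in> V)" for V :: "'a linf set"
    by (simp add: open_linf_def)
  show "(norm f = 0) = (f = 0)"
  proof
    assume "norm f = 0"
    then show "f = 0"
      using linf_le_norm[of f] by (intro linf_eqI) (simp add: zero_linf.rep_eq)
  qed (simp add: norm_linf.rep_eq zero_linf.rep_eq)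
  show "norm (f + g) \<le> norm f + norm g"
    by (rule linf_normI) (metis app(1) linf_le_norm norm_triangle_mono)
  have le: "norm (r *\<^sub>R f) \<le> \<bar>r\<bar> * norm f" for r and f :: "'a linf"
    by (rule linf_normI) (simp add: app norm_mult linf_le_norm mult_left_mono)
  show "norm (r *\<^sub>R f) = \<bar>r\<bar> * norm f"
  proof (cases "r = 0")
    case True
    then show ?thesis
      using le[of r f] linf_norm_pos[of "r *\<^sub>R f"] by simp
  next
    case False
    have "inverse r *\<^sub>R r *\<^sub>R f = f"
      using False by (intro linf_eqI) (simp add: app)
    then have "norm f \<le> inverse \<bar>r\<bar> * norm (r *\<^sub>R f)"
      using le[of "inverse r" "r *\<^sub>R f"] by simp
    then have "\<bar>r\<bar> * norm f \<le> norm (r *\<^sub>R f)"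
      using False by (simp add: field_simps)
    with le[of r f] show ?thesis by simp
  qed
  show "norm (f * g) \<le> norm f * norm g"
    by (rule linf_normI)
      (simp add: app norm_mult linf_le_norm linf_norm_pos mult_mono)
qed

end

lemmas linf_apply_simps = plus_linf.rep_eq uminus_linf.rep_eq minus_linf.rep_eq
  zero_linf.rep_eq one_linf.rep_eq times_linf.rep_eq scaleC_linf.rep_eq linf_apply_scaleR

instance linf :: (type) banach
proof
  fix X :: "nat \<Rightarrow> 'a linf"
  assume X: "Cauchy X"
  have le: "dist (linf_apply (X m) x) (linf_apply (X n) x) \<le> dist (X m) (X n)" for m n x
    using linf_le_norm[of "X m - X n" x] by (simp add: dist_norm linf_apply_simps)
  have "Cauchy (\<lambda>n. linf_apply (X n) x)" for x
    using X le unfolding Cauchy_def by (meson order_le_less_trans)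
  then have "\<exists>l. (\<lambda>n. linf_apply (X n) x) \<longlonglongrightarrow> l" for x
    using Cauchy_convergent convergent_def by blast
  then obtain l where l: "\<And>x. (\<lambda>n. linf_apply (X n) x) \<longlonglongrightarrow> l x"
    by metis
  have close: "\<exists>N. \<forall>n\<ge>N. \<forall>x. cmod (linf_apply (X n) x - l x) \<le> e" if "e > 0" for e
  proof -
    obtain N where N: "\<And>m n. m \<ge> N \<Longrightarrow> n \<ge> N \<Longrightarrow> dist (X m) (X n) < e"
      using X \<open>e > 0\<close> unfolding Cauchy_def by meson
    have "cmod (linf_apply (X n) x - l x) \<le> e" if "n \<ge> N" for n x
    proof (rule LIMSEQ_le_const2)
      show "(\<lambda>m. cmod (linf_apply (X n) x - linf_apply (X m) x))
          \<longlonglongrightarrow> cmod (linf_apply (X n) x - l x)"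
        by (intro tendsto_intros l)
      show "\<exists>M. \<forall>m\<ge>M. cmod (linf_apply (X n) x - linf_apply (X m) x) \<le> e"
        using N[OF that] le[of n x] by (metis dist_norm less_imp_le order_trans)
    qed
    then show ?thesis by blast
  qed
  obtain N where N: "\<And>x. cmod (linf_apply (X N) x - l x) \<le> 1"
    using close[of 1] by auto
  have "cmod (l x) \<le> norm (X N) + 1" for x
    using N[of x] linf_le_norm[of "X N" x] norm_triangle_ineq3[of "l x" "linf_apply (X N) x"]
    by (simp add: norm_minus_commute)
  then have "bounded (range l)"
    unfolding bounded_range_iff by blast
  then have L: "linf_apply (Linf l) = l"
    by (simp add: Linf_inverse)
  have "X \<longlonglongrightarrow> Linf l"
  proof (rule LIMSEQ_I)
    fix e :: real assume e: "e > 0"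
    obtain M where M: "\<And>n x. n \<ge> M \<Longrightarrow> cmod (linf_apply (X n) x - l x) \<le> e / 2"
      using close[of "e / 2"] e by auto
    have "norm (X n - Linf l) \<le> e / 2" if "n \<ge> M" for n
      by (rule linf_normI) (use M[OF that] in \<open>simp add: linf_apply_simps L\<close>)
    moreover have "e / 2 < e" using e by simp
    ultimately show "\<exists>M. \<forall>n\<ge>M. norm (X n - Linf l) < e"
      by (meson order_le_less_trans)
  qed
  then show "convergent X" by (rule convergentI)
qed

instantiation linf :: (type) unital_cstar_algebra
begin

lift_definition star_linf :: "'a linf \<Rightarrow> 'a linf" is "\<lambda>f x. cnj (f x)"
  by (simp add: bounded_range_iff)

instance
proof
  fix f g h :: "'a linf" and c d :: complex
  note app = linf_apply_simps star_linf.rep_eq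
  show "(c \<cdot>\<^sub>C f) * g = c \<cdot>\<^sub>C (f * g)" "f * (c \<cdot>\<^sub>C g) = c \<cdot>\<^sub>C (f * g)"
    "(f\<^sup>\<star>)\<^sup>\<star> = f" "(f + g)\<^sup>\<star> = f\<^sup>\<star> + g\<^sup>\<star>" "(c \<cdot>\<^sub>C f)\<^sup>\<star> = cnj c \<cdot>\<^sub>C f\<^sup>\<star>"
    "(f * g)\<^sup>\<star> = g\<^sup>\<star> * f\<^sup>\<star>"
    by (rule linf_eqI; simp add: app algebra_simps)+
  have le: "norm (c \<cdot>\<^sub>C f) \<le> cmod c * norm f" for c and f :: "'a linf"
    by (rule linf_normI) (simp add: app norm_mult linf_le_norm mult_left_mono)
  show "norm (c \<cdot>\<^sub>C f) = cmod c * norm f"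
  proof (cases "c = 0")
    case True
    then show ?thesis
      using le[of c f] norm_ge_zero[of "c \<cdot>\<^sub>C f"] by simp
  next
    case False
    have "inverse c \<cdot>\<^sub>C c \<cdot>\<^sub>C f = f"
      using False by (intro linf_eqI) (simp add: app)
    then have "norm f \<le> inverse (cmod c) * norm (c \<cdot>\<^sub>C f)"
      using le[of "inverse c" "c \<cdot>\<^sub>C f"] by (simp add: norm_inverse)
    then have "cmod c * norm f \<le> norm (c \<cdot>\<^sub>C f)"
      using False by (simp add: field_simps)
    with le[of c f] show ?thesis by simp
  qed
  show "norm (f\<^sup>\<star> * f) = (norm f)\<^sup>2"
  proof (rule antisym)
    show "norm (f\<^sup>\<star> * f) \<le> (norm f)\<^sup>2"
      by (rule linf_normI)
        (simp add: app norm_mult power2_eq_square linf_le_norm mult_mono)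
    have "norm f \<le> sqrt (norm (f\<^sup>\<star> * f))"
    proof (rule linf_normI)
      fix x
      have "(cmod (linf_apply f x))\<^sup>2 \<le> norm (f\<^sup>\<star> * f)"
        using linf_le_norm[of "f\<^sup>\<star> * f" x] by (simp add: app norm_mult power2_eq_square)
      then show "cmod (linf_apply f x) \<le> sqrt (norm (f\<^sup>\<star> * f))"
        by (rule real_le_rsqrt)
    qed
    then show "(norm f)\<^sup>2 \<le> norm (f\<^sup>\<star> * f)"
      by (metis norm_ge_zero power_mono real_sqrt_pow2)
  qed
qed

end


section \<open>Subalgebras, homomorphisms, representations\<close>

definition cstar_subalgebra :: "'a :: unital_cstar_algebra set \<Rightarrow> bool" where
  "cstar_subalgebra C \<longleftrightarrow> closed C \<and> 0 \<in> C \<and> (\<forall>x\<in>C. \<forall>y\<in>C. x + y \<in> C \<and> x * y \<in> C) \<and>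
     (\<forall>c. \<forall>x\<in>C. c \<cdot>\<^sub>C x \<in> C) \<and> (\<forall>x\<in>C. x\<^sup>\<star> \<in> C)"

text \<open>The C*-subalgebra generated by \<open>S\<close> is \<^term>\<open>cstar_subalgebra hull S\<close>.\<close>

definition star_hom_on ::
  "'a :: unital_cstar_algebra set \<Rightarrow> ('a \<Rightarrow> 'b :: unital_cstar_algebra) \<Rightarrow> bool" where
  "star_hom_on A \<phi> \<longleftrightarrow> (\<forall>x\<in>A. \<forall>y\<in>A. \<phi> (x + y) = \<phi> x + \<phi> y \<and> \<phi> (x * y) = \<phi> x * \<phi> y) \<and>
     (\<forall>c. \<forall>x\<in>A. \<phi> (c \<cdot>\<^sub>C x) = c \<cdot>\<^sub>C \<phi> x) \<and> (\<forall>x\<in>A. \<phi> (x\<^sup>\<star>) = (\<phi> x)\<^sup>\<star>)"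

text \<open>Nondegeneracy: \<open>\<phi>(A)B\<close> spans a dense subspace of \<open>B\<close>, respectively \<open>\<pi>(A)H\<close> one of
  \<open>H\<close>. Both sets are closed under complex multiples, so the real span is the complex span.\<close>

definition nondegenerate_hom ::
  "'a :: unital_cstar_algebra set \<Rightarrow> ('a \<Rightarrow> 'b :: unital_cstar_algebra) \<Rightarrow> bool" where
  "nondegenerate_hom A \<phi> \<longleftrightarrow> star_hom_on A \<phi> \<and> closure (span {\<phi> a * b | a b. a \<in> A}) = UNIV"

definition nondegenerate_rep ::
  "'a :: unital_cstar_algebra set \<Rightarrow> ('a \<Rightarrow> 'h :: complex_hilbert bop) \<Rightarrow> bool" where
  "nondegenerate_rep A \<pi> \<longleftrightarrow>
     star_hom_on A \<pi> \<and> closure (span {bop_apply (\<pi> a) h | a h. a \<in> A}) = UNIV"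


section \<open>Left LCM semigroups and their partial-isometric representations\<close>

text \<open>The product is a parameter, so that the opposite semigroup can be treated as well.\<close>

definition left_LCM :: "('p \<Rightarrow> 'p \<Rightarrow> 'p) \<Rightarrow> bool" where
  "left_LCM m \<longleftrightarrow> (\<forall>x y z. m x z = m y z \<longrightarrow> x = y) \<and>
     (\<forall>x y. range (\<lambda>p. m p x) \<inter> range (\<lambda>p. m p y) = {} \<or>
            (\<exists>z. range (\<lambda>p. m p x) \<inter> range (\<lambda>p. m p y) = range (\<lambda>p. m p z)))"

definition opposite :: "('p \<Rightarrow> 'p \<Rightarrow> 'p) \<Rightarrow> 'p \<Rightarrow> 'p \<Rightarrow> 'p" where
  "opposite m x y = m y x"

definition left_ideal :: "'p :: monoid_mult \<Rightarrow> 'p set" where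
  "left_ideal x = range (\<lambda>p. p * x)"

definition right_ideal :: "'p :: monoid_mult \<Rightarrow> 'p set" where
  "right_ideal x = range (\<lambda>p. x * p)"

definition partial_isometry :: "'a :: unital_cstar_algebra \<Rightarrow> bool" where
  "partial_isometry v \<longleftrightarrow> v * v\<^sup>\<star> * v = v"

definition piso_rep :: "('p :: monoid_mult \<Rightarrow> 'a :: unital_cstar_algebra) \<Rightarrow> bool" where
  "piso_rep V \<longleftrightarrow> V 1 = 1 \<and> (\<forall>x y. V (x * y) = V x * V y) \<and> (\<forall>x. partial_isometry (V x))"

definition right_nica :: "('p :: monoid_mult \<Rightarrow> 'a :: unital_cstar_algebra) \<Rightarrow> bool" where
  "right_nica V \<longleftrightarrow>
     (\<forall>x y z. left_ideal x \<inter> left_ideal y = left_ideal z \<longrightarrow>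
        (V x)\<^sup>\<star> * V x * (V y)\<^sup>\<star> * V y = (V z)\<^sup>\<star> * V z) \<and>
     (\<forall>x y. left_ideal x \<inter> left_ideal y = {} \<longrightarrow> (V x)\<^sup>\<star> * V x * (V y)\<^sup>\<star> * V y = 0)"

definition left_nica :: "('p :: monoid_mult \<Rightarrow> 'a :: unital_cstar_algebra) \<Rightarrow> bool" where
  "left_nica V \<longleftrightarrow>
     (\<forall>x y z. right_ideal x \<inter> right_ideal y = right_ideal z \<longrightarrow>
        V x * (V x)\<^sup>\<star> * V y * (V y)\<^sup>\<star> = V z * (V z)\<^sup>\<star>) \<and>
     (\<forall>x y. right_ideal x \<inter> right_ideal y = {} \<longrightarrow> V x * (V x)\<^sup>\<star> * V y * (V y)\<^sup>\<star> = 0)"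

definition nica_piso_rep :: "('p :: monoid_mult \<Rightarrow> 'a :: unital_cstar_algebra) \<Rightarrow> bool" where
  "nica_piso_rep V \<longleftrightarrow> piso_rep V \<and> right_nica V"

definition bicovariant_piso_rep ::
  "('p :: monoid_mult \<Rightarrow> 'a :: unital_cstar_algebra) \<Rightarrow> bool" where
  "bicovariant_piso_rep V \<longleftrightarrow> nica_piso_rep V \<and> left_nica V"


section \<open>Unital dynamical systems and partial-isometric crossed products\<close>

text \<open>The algebra of the system is a C*-subalgebra \<open>A\<close> of an ambient unital C*-algebra,
  containing its unit. As \<open>A\<close> is unital, \<open>M(A) = A\<close> and the strict topology is the norm
  topology. Values of \<open>\<alpha>\<close> outside \<open>A\<close> are irrelevant.\<close>

definition unital_cstar_system ::
  "'a :: unital_cstar_algebra set \<Rightarrow> ('p :: monoid_mult \<Rightarrow> 'a \<Rightarrow> 'a) \<Rightarrow> bool" where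
  "unital_cstar_system A \<alpha> \<longleftrightarrow> cstar_subalgebra A \<and> 1 \<in> A \<and>
     (\<forall>x. \<alpha> x ` A \<subseteq> A \<and> star_hom_on A (\<alpha> x) \<and> continuous_on A (\<alpha> x)) \<and>
     (\<forall>a\<in>A. \<alpha> 1 a = a) \<and> (\<forall>x y. \<forall>a\<in>A. \<alpha> (x * y) a = \<alpha> x (\<alpha> y a))"

definition covariant_pair ::
  "'a :: unital_cstar_algebra set \<Rightarrow> ('p :: monoid_mult \<Rightarrow> 'a \<Rightarrow> 'a) \<Rightarrow>
   ('a \<Rightarrow> 'b :: unital_cstar_algebra) \<Rightarrow> ('p \<Rightarrow> 'b) \<Rightarrow> bool" where
  "covariant_pair A \<alpha> \<pi> V \<longleftrightarrow> star_hom_on A \<pi> \<and> nica_piso_rep V \<and>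
     (\<forall>a\<in>A. \<forall>x. \<pi> (\<alpha> x a) = V x * \<pi> a * (V x)\<^sup>\<star>) \<and>
     (\<forall>a\<in>A. \<forall>x. (V x)\<^sup>\<star> * V x * \<pi> a = \<pi> a * ((V x)\<^sup>\<star> * V x))"

text \<open>A partial-isometric crossed product \<open>(B, i\<^sub>A, i\<^sub>P)\<close>, where \<open>B\<close> is the type \<^typ>\<open>'b\<close>.
  Since \<open>A\<close> is unital and \<open>i\<^sub>A\<close> is nondegenerate, \<open>B\<close> has the unit \<open>i\<^sub>A(1)\<close>, so \<open>M(B) = B\<close>
  and no extension of homomorphisms to multiplier algebras is needed.
  HOL cannot quantify over types, so the Hilbert spaces of the universal property are those
  carried by the type \<^typ>\<open>'h\<close>, which is a parameter. The crossed product satisfies this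
  for every \<^typ>\<open>'h\<close>.\<close>

definition piso_crossed_product ::
  "'h :: complex_hilbert itself \<Rightarrow> 'a :: unital_cstar_algebra set \<Rightarrow>
   ('p :: monoid_mult \<Rightarrow> 'a \<Rightarrow> 'a) \<Rightarrow> ('a \<Rightarrow> 'b :: unital_cstar_algebra) \<Rightarrow> ('p \<Rightarrow> 'b) \<Rightarrow> bool" where
  "piso_crossed_product TYPE('h) A \<alpha> i\<^sub>A i\<^sub>P \<longleftrightarrow>
     unital_cstar_system A \<alpha> \<and>
     nondegenerate_hom A i\<^sub>A \<and> inj_on i\<^sub>A A \<and> covariant_pair A \<alpha> i\<^sub>A i\<^sub>P \<and>
     (\<forall>(\<pi> :: 'a \<Rightarrow> 'h bop) V. nondegenerate_rep A \<pi> \<and> covariant_pair A \<alpha> \<pi> V \<longrightarrow>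
        (\<exists>\<Phi> :: 'b \<Rightarrow> 'h bop. nondegenerate_rep UNIV \<Phi> \<and>
            (\<forall>a\<in>A. \<Phi> (i\<^sub>A a) = \<pi> a) \<and> \<Phi> \<circ> i\<^sub>P = V)) \<and>
     cstar_subalgebra hull {i\<^sub>A a * i\<^sub>P x | a x. a \<in> A} = UNIV"


section \<open>The system on the algebra of right ideals\<close>

lift_definition ideal_ind :: "'p :: monoid_mult \<Rightarrow> 'p linf" is
  "\<lambda>y t. if t \<in> right_ideal y then 1 else 0"
  unfolding bounded_range_iff by (rule exI[of _ 1]) simp

definition B_alg :: "'p :: monoid_mult linf set" where
  "B_alg = cstar_subalgebra hull (range ideal_ind)"

text \<open>The element \<open>r\<close> with \<open>t = xr\<close> is unique when \<open>P\<close> is left cancellative, that is, when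
  the opposite semigroup is right cancellative.\<close>

lift_definition shift :: "'p :: monoid_mult \<Rightarrow> 'p linf \<Rightarrow> 'p linf" is
  "\<lambda>x f t. if \<exists>r. t = x * r then f (THE r. t = x * r) else 0"
proof -
  fix x :: 'p and f :: "'p \<Rightarrow> complex"
  assume "bounded (range f)"
  then obtain K where "\<And>t. norm (f t) \<le> K" by (auto simp: bounded_range_iff)
  moreover from this[of 1] have "0 \<le> K" using norm_ge_zero order_trans by blast
  ultimately show "bounded (range (\<lambda>t. if \<exists>r. t = x * r then f (THE r. t = x * r) else 0))"
    unfolding bounded_range_iff by (intro exI[of _ K]) simp
qed

lemma shift_apply:
  assumes "left_LCM (opposite ((*) :: 'p :: monoid_mult \<Rightarrow> 'p \<Rightarrow> 'p))"
  shows "linf_apply (shift (x :: 'p) f) (x * r) = linf_apply f r"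
    and "t \<notin> right_ideal x \<Longrightarrow> linf_apply (shift x f) t = 0"
proof -
  have inj: "x * r = x * s \<Longrightarrow> r = s" for r s
    using assms by (auto simp: left_LCM_def opposite_def)
  then have "(THE s. x * r = x * s) = r"
    by (blast intro: the_equality)
  then show "linf_apply (shift x f) (x * r) = linf_apply f r"
    by (auto simp: shift.rep_eq)
  show "t \<notin> right_ideal x \<Longrightarrow> linf_apply (shift x f) t = 0"
    by (auto simp: shift.rep_eq right_ideal_def)
qed

lemma B_alg_system:
  assumes "left_LCM (opposite ((*) :: 'p :: monoid_mult \<Rightarrow> 'p \<Rightarrow> 'p))"
  shows "shift (x :: 'p) (ideal_ind y) = ideal_ind (x * y)"
    and "unital_cstar_system B_alg (shift :: 'p \<Rightarrow> _)"
proof -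
  note sh = shift_apply[OF assms]
  have inj: "x * r = x * s \<longleftrightarrow> r = s" for x r s :: 'p
    using assms by (auto simp: left_LCM_def opposite_def)
  have eqI: "shift x f = g"
    if "\<And>r. linf_apply g (x * r) = linf_apply f r"
      and "\<And>t. t \<notin> right_ideal x \<Longrightarrow> linf_apply g t = 0" for x :: 'p and f g
  proof (rule linf_eqI)
    show "linf_apply (shift x f) t = linf_apply g t" for t
      by (cases "t \<in> right_ideal x") (auto simp: right_ideal_def sh that)
  qed
  show ind: "shift x (ideal_ind y) = ideal_ind (x * y)" for x y :: 'p
    by (rule eqI) (auto simp: ideal_ind.rep_eq right_ideal_def mult.assoc inj)
  have hom: "shift x (f + g) = shift x f + shift x g" "shift x (f * g) = shift x f * shift x g"
    "shift x (c \<cdot>\<^sub>C f) = c \<cdot>\<^sub>C shift x f" "shift x (f\<^sup>\<star>) = (shift x f)\<^sup>\<star>" "shift x 0 = 0"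
    for x :: 'p and f g c
    by (rule eqI; simp add: linf_apply_simps star_linf.rep_eq sh)+
  have contr: "norm (shift x f) \<le> norm f" for x :: 'p and f
  proof (rule linf_normI)
    show "cmod (linf_apply (shift x f) t) \<le> norm f" for t
      by (cases "t \<in> right_ideal x") (auto simp: right_ideal_def sh linf_le_norm)
  qed
  have scaleR: "shift x (r *\<^sub>R f) = r *\<^sub>R shift x f" for x :: 'p and r f
    by (simp add: scaleR_eq_scaleC hom)
  have bl: "bounded_linear (shift x)" for x :: 'p
    by (rule bounded_linear_intro[of _ 1]) (simp_all add: hom scaleR contr)
  have cont: "continuous_on S (shift x)" for S and x :: 'p
    by (rule linear_continuous_on[OF bl])
  have alg: "cstar_subalgebra (B_alg :: 'p linf set)"
    unfolding B_alg_def
    by (rule hull_in) (auto simp: cstar_subalgebra_def intro: closed_Inter)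
  have in_B: "ideal_ind y \<in> B_alg" for y :: 'p
    unfolding B_alg_def by (rule hull_inc) simp
  have "ideal_ind (1::'p) = 1"
    by (rule linf_eqI) (simp add: ideal_ind.rep_eq right_ideal_def linf_apply_simps)
  then have one: "1 \<in> (B_alg :: 'p linf set)"
    using in_B by metis
  have maps: "shift x ` B_alg \<subseteq> B_alg" for x :: 'p
  proof -
    have "cstar_subalgebra (shift x -` B_alg)"
      using alg closed_vimage[OF _ cont, of "B_alg" x]
      by (auto simp: cstar_subalgebra_def hom)
    then have "B_alg \<subseteq> shift x -` B_alg"
      by (subst B_alg_def, intro hull_minimal) (auto simp: ind in_B)
    then show ?thesis by blast
  qed
  have "shift 1 f = f" for f :: "'p linf"
    by (rule eqI) (auto simp: right_ideal_def)
  moreover have "shift (x * y) f = shift x (shift y f)" for x y :: 'p and f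
  proof (rule eqI)
    show "linf_apply (shift x (shift y f)) (x * y * r) = linf_apply f r" for r
      by (simp add: mult.assoc sh)
    show "linf_apply (shift x (shift y f)) t = 0" if "t \<notin> right_ideal (x * y)" for t
    proof (cases "t \<in> right_ideal x")
      case True
      then obtain r where "t = x * r" by (auto simp: right_ideal_def)
      moreover from this that have "r \<notin> right_ideal y"
        by (auto simp: right_ideal_def mult.assoc)
      ultimately show ?thesis by (simp add: sh)
    qed (simp add: sh)
  qed
  ultimately show "unital_cstar_system B_alg (shift :: 'p \<Rightarrow> _)"
    using alg one maps cont by (simp add: unital_cstar_system_def star_hom_on_def hom)
qed

end

theory Submission
  imports Defs
begin

text \<open>
  The idea is that left Nica covariance of \<open>V\<close> says exactly that the projections
  \<open>V\<^sub>xV\<^sub>x\<^sup>\<star>\<close> multiply like the indicator functions \<open>1\<^sub>x\<close> of the right ideals \<open>xP\<close>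
  (\<open>left_nica_iff_ideal_projections\<close>). The covariance of the pair \<open>(i\<^sub>B, i\<^sub>P)\<close>, taken at
  \<open>a = 1\<close>, gives \<open>i\<^sub>B(1\<^sub>x) = i\<^sub>P(x)i\<^sub>P(x)\<^sup>\<star>\<close>. Hence \<open>i\<^sub>P\<close> is left Nica covariant. The same
  identity places the images of the generators \<open>1\<^sub>x\<close> in the C*-algebra generated by \<open>i\<^sub>P\<close>; that
  all of \<open>i\<^sub>B(B\<^sub>P)\<close> lies there needs the continuity of \<open>i\<^sub>B\<close>.

  Conversely, let \<open>V\<close> be bicovariant on a Hilbert space. By the universal property of the crossed
  product it is enough to find \<open>\<pi>\<close> on \<open>B\<^sub>P\<close> with \<open>\<pi>(1\<^sub>y) = V\<^sub>yV\<^sub>y\<^sup>\<star>\<close> that is covariant with \<open>V\<close>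
  (\<open>bicovariant_covariant_pair\<close>). Both covariance relations are equalities of continuous linear
  maps of \<open>a\<close>, so they need checking on \<open>a = 1\<^sub>y\<close> only. There the first one is
  \<open>V\<^sub>x\<^sub>yV\<^sub>x\<^sub>y\<^sup>\<star> = V\<^sub>xV\<^sub>yV\<^sub>y\<^sup>\<star>V\<^sub>x\<^sup>\<star>\<close>, and the second one says that the projections \<open>V\<^sub>x\<^sup>\<star>V\<^sub>x\<close> and
  \<open>V\<^sub>yV\<^sub>y\<^sup>\<star>\<close> commute, which they do because the product \<open>V\<^sub>xV\<^sub>y\<close> is a partial isometry.

  Two analytic facts carry the argument.

  \<^item> A \<open>\<star>\<close>-homomorphism from a unital algebra of bounded functions to any C*-algebra is contractive
    (\<open>star_hom_on_linf_contractive\<close>). A real function \<open>h\<close> with \<open>\<bar>h\<bar> \<le> 1\<close> is the mean of the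
    unitary \<open>h + i\<surd>(1 - h\<^sup>2)\<close> and its adjoint, and \<open>\<star>\<close>-homomorphisms do not increase the norm of
    unitaries. This avoids spectral theory in the target.

  \<^item> The representation \<open>\<pi>\<close> exists (\<open>B_alg_representation\<close>) because
    \<open>\<parallel>\<Sum> c\<^sub>y V\<^sub>yV\<^sub>y\<^sup>\<star>\<parallel> \<le> \<parallel>\<Sum> c\<^sub>y 1\<^sub>y\<parallel>\<close> (\<open>norm_lin_comb_le\<close>). Commuting projections are
    diagonalised simultaneously, and the LCM property yields, for every joint eigenvector, a point of
    \<open>P\<close> at which the function on the right takes the corresponding eigenvalue.
\<close>

section \<open>Elementary facts about C*-algebras\<close>

lemma scaleC_zero_left: "0 \<cdot>\<^sub>C x = (0 :: 'a :: complex_vect)"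
  using scaleR_eq_scaleC[of 0 x] by simp

lemma scaleC_zero_right: "c \<cdot>\<^sub>C 0 = (0 :: 'a :: complex_vect)"
  using scaleC_add_right[of c 0 "0 :: 'a"] by simp

lemma star_zero: "(0 :: 'a :: unital_cstar_algebra)\<^sup>\<star> = 0"
  using star_scaleC[of 0 "0 :: 'a"] by (simp add: scaleC_zero_left)

lemma star_one: "(1 :: 'a :: unital_cstar_algebra)\<^sup>\<star> = 1"
  by (metis mult_1_left mult_1_right star_mult star_star)

lemma star_diff: "(x - y)\<^sup>\<star> = x\<^sup>\<star> - (y :: 'a :: unital_cstar_algebra)\<^sup>\<star>"
  using star_add[of "x - y" y] by (simp add: algebra_simps)

lemma norm_star: "norm (x\<^sup>\<star>) = norm (x :: 'a :: unital_cstar_algebra)"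
proof -
  have le: "norm x \<le> norm (x\<^sup>\<star>)" for x :: 'a
  proof (cases "x = 0")
    case False
    have "norm x * norm x \<le> norm (x\<^sup>\<star>) * norm x"
      using norm_mult_ineq[of "x\<^sup>\<star>" x] by (simp add: cstar_identity power2_eq_square)
    with False show ?thesis by simp
  qed simp
  from le[of x] le[of "x\<^sup>\<star>"] show ?thesis by (simp add: star_star)
qed

lemma star_mult_self_eq_0D: "x\<^sup>\<star> * x = 0 \<Longrightarrow> x = (0 :: 'a :: unital_cstar_algebra)"
  using cstar_identity[of x] by simp

lemma norm_projection_le_1:
  assumes "p\<^sup>\<star> = p" "p * p = (p :: 'a :: unital_cstar_algebra)"
  shows "norm p \<le> 1"
  using cstar_identity[of p] assms
  by (cases "norm p = 0") (simp_all add: power2_eq_square)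

lemma tendsto_scaleC:
  "(f \<longlongrightarrow> l) F \<Longrightarrow> ((\<lambda>x. c \<cdot>\<^sub>C f x) \<longlongrightarrow> c \<cdot>\<^sub>C (l :: 'a :: unital_cstar_algebra)) F"
  by (rule bounded_linear.tendsto, rule bounded_linear_intro[of _ "cmod c"])
    (simp_all add: scaleC_add_right scaleR_eq_scaleC scaleC_scaleC norm_scaleC mult.commute)

lemma tendsto_star:
  "(f \<longlongrightarrow> l) F \<Longrightarrow> ((\<lambda>x. (f x)\<^sup>\<star>) \<longlongrightarrow> (l :: 'a :: unital_cstar_algebra)\<^sup>\<star>) F"
  by (rule bounded_linear.tendsto, rule bounded_linear_intro[of _ 1])
    (simp_all add: star_add scaleR_eq_scaleC star_scaleC norm_star)

text \<open>For projections \<open>p\<close>, \<open>q\<close> the product \<open>pq\<close> is idempotent only if they commute: the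
  C*-identity turns \<open>(qp - pqp)\<^sup>\<star>(qp - pqp) = 0\<close> into \<open>qp = pqp\<close>, and \<open>pqp\<close> is self-adjoint.
  The initial projection of \<open>v\<close> and the final projection of \<open>w\<close> are in this situation when
  \<open>vw\<close> is again a partial isometry.\<close>

lemma partial_isometry_mult_imp_commute:
  fixes v w :: "'a :: unital_cstar_algebra"
  assumes vw: "partial_isometry (v * w)"
    and v: "partial_isometry v" and w: "partial_isometry w"
  shows "v\<^sup>\<star> * v * (w * w\<^sup>\<star>) = w * w\<^sup>\<star> * (v\<^sup>\<star> * v)"
proof -
  define p where "p = v\<^sup>\<star> * v"
  define q where "q = w * w\<^sup>\<star>"
  have sa: "p\<^sup>\<star> = p" "q\<^sup>\<star> = q"
    by (simp_all add: p_def q_def star_mult star_star)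
  have pp: "p * p = p"
    using v by (simp add: p_def partial_isometry_def mult.assoc)
  have qq: "q * q = q"
    using w by (simp add: q_def partial_isometry_def mult.assoc[symmetric])
  have "v\<^sup>\<star> * (v * w * (v * w)\<^sup>\<star> * (v * w)) * w\<^sup>\<star> = v\<^sup>\<star> * (v * w) * w\<^sup>\<star>"
    using vw by (simp only: partial_isometry_def)
  then have idem: "p * (q * (p * q)) = p * q"
    by (simp add: p_def q_def star_mult mult.assoc)
  have pp': "p * (p * x) = p * x" and qq': "q * (q * x) = q * x"
    and idem': "p * (q * (p * (q * x))) = p * (q * x)" for x
    using pp qq idem by (metis mult.assoc)+
  \<comment> \<open>By \<open>idem\<close> each of the four terms of the expanded product is \<open>pqp\<close>, and their signs cancel.\<close>
  have "(q * p - p * q * p)\<^sup>\<star> * (q * p - p * q * p) = 0"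
    by (simp add: star_diff star_mult sa mult.assoc left_diff_distrib right_diff_distrib
        pp pp' qq' idem')
  then have "q * p = p * q * p"
    using star_mult_self_eq_0D by fastforce
  moreover from this have "p * q = p * q * p"
    using sa by (metis star_mult mult.assoc)
  ultimately show ?thesis by (simp add: p_def q_def)
qed


section \<open>Linear combinations\<close>

text \<open>Combinations of \<open>1\<^sub>y\<close> and of the operators that are to represent them have to be compared before
the representation is known to be well defined. The list of coefficients and indices is the common
name of the two.\<close>

definition lin_comb :: "('i \<Rightarrow> 'a :: complex_vect) \<Rightarrow> (complex \<times> 'i) list \<Rightarrow> 'a" where
  "lin_comb g xs = (\<Sum>(c, y)\<leftarrow>xs. c \<cdot>\<^sub>C g y)"

lemma lin_comb_simps [simp]:
  "lin_comb g [] = 0"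
  "lin_comb g ((c, y) # xs) = c \<cdot>\<^sub>C g y + lin_comb g xs"
  "lin_comb g (xs @ ys) = lin_comb g xs + lin_comb g ys"
  by (simp_all add: lin_comb_def)

lemma scaleC_lin_comb: "c \<cdot>\<^sub>C lin_comb g xs = lin_comb g (map (apfst ((*) c)) xs)"
  by (induction xs) (auto simp: scaleC_zero_right scaleC_add_right scaleC_scaleC)

lemma star_lin_comb:
  assumes "\<And>y. (g y)\<^sup>\<star> = g y"
  shows "(lin_comb g xs)\<^sup>\<star> = lin_comb g (map (apfst cnj) xs)"
  using assms by (induction xs) (auto simp: star_zero star_add star_scaleC)

lemma lin_comb_in_subalgebra:
  assumes "cstar_subalgebra A" and "\<And>y. g y \<in> A"
  shows "lin_comb g xs \<in> A"
  using assms by (induction xs) (auto simp: cstar_subalgebra_def)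

lemma map_lin_comb:
  assumes A: "cstar_subalgebra A" and g: "\<And>y. g y \<in> A"
    and add: "\<And>a b. a \<in> A \<Longrightarrow> b \<in> A \<Longrightarrow> f (a + b) = f a + f b"
    and scale: "\<And>c a. a \<in> A \<Longrightarrow> f (c \<cdot>\<^sub>C a) = c \<cdot>\<^sub>C f a"
  shows "f (lin_comb g xs) = lin_comb (\<lambda>y. f (g y)) xs"
proof (induction xs)
  case Nil
  have "0 \<in> A" using A by (simp add: cstar_subalgebra_def)
  from scale[OF this, of 0] show ?case by (simp add: scaleC_zero_left)
next
  case (Cons z xs)
  obtain c y where "z = (c, y)" by (cases z)
  moreover have "c \<cdot>\<^sub>C g y \<in> A" using A g by (simp add: cstar_subalgebra_def)
  ultimately show ?case
    using Cons lin_comb_in_subalgebra[of A g xs, OF A g] g by (simp add: add scale)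
qed


section \<open>Homomorphisms on algebras of bounded functions are contractive\<close>

lemma cstar_subalgebra_hull: "cstar_subalgebra (cstar_subalgebra hull S)"
  by (rule hull_in) (auto simp: cstar_subalgebra_def intro: closed_Inter)

lemma linf_self_adjoint_real:
  assumes "h\<^sup>\<star> = h"
  shows "of_real (Re (linf_apply h t)) = linf_apply h t"
  using assms by (metis Reals_cnj_iff of_real_Re star_linf.rep_eq)

text \<open>The functions \<open>p \<circ> h\<close> with \<open>p\<close> a polynomial lie in \<open>A\<close>, and by the Weierstrass theorem they
approximate \<open>F \<circ> h\<close> uniformly.\<close>

lemma linf_functional_calculus:
  fixes A :: "'p linf set"
  assumes A: "cstar_subalgebra A" and one: "1 \<in> A"
    and h: "h \<in> A" and sa: "h\<^sup>\<star> = h"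
    and F: "continuous_on {- norm h..norm h} F"
  shows "\<exists>g\<in>A. \<forall>t. linf_apply g t = of_real (F (Re (linf_apply h t)))"
proof -
  note real = linf_self_adjoint_real[OF sa]
  have range: "Re (linf_apply h t) \<in> {- norm h..norm h}" for t
    using linf_le_norm[of h t] abs_Re_le_cmod[of "linf_apply h t"] by auto
  have poly: "\<exists>g\<in>A. \<forall>t. linf_apply g t = of_real (p (Re (linf_apply h t)))"
    if "real_polynomial_function p" for p :: "real \<Rightarrow> real"
    using that
  proof induction
    case (linear f)
    then interpret bounded_linear f .
    have "f x = x * f 1" for x using scaleR[of x 1] by simp
    then have "linf_apply (of_real (f 1) \<cdot>\<^sub>C h) t = of_real (f (Re (linf_apply h t)))" for t
      using real[of t] by (metis linf_apply_simps(7) of_real_mult mult.commute)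
    moreover have "of_real (f 1) \<cdot>\<^sub>C h \<in> A"
      using A h by (simp add: cstar_subalgebra_def)
    ultimately show ?case by blast
  next
    case (const c)
    have "of_real c \<cdot>\<^sub>C 1 \<in> A" using A one by (simp add: cstar_subalgebra_def)
    moreover have "linf_apply (of_real c \<cdot>\<^sub>C 1) t = of_real c" for t :: 'p
      by (simp add: linf_apply_simps)
    ultimately show ?case by blast
  next
    case (add f g)
    then obtain a b where "a \<in> A" "b \<in> A"
      "\<And>t. linf_apply a t = of_real (f (Re (linf_apply h t)))"
      "\<And>t. linf_apply b t = of_real (g (Re (linf_apply h t)))" by blast
    then show ?case
      using A by (intro bexI[of _ "a + b"]) (simp_all add: linf_apply_simps cstar_subalgebra_def)
  next
    case (mult f g)
    then obtain a b where "a \<in> A" "b \<in> A"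
      "\<And>t. linf_apply a t = of_real (f (Re (linf_apply h t)))"
      "\<And>t. linf_apply b t = of_real (g (Re (linf_apply h t)))" by blast
    then show ?case
      using A by (intro bexI[of _ "a * b"]) (simp_all add: linf_apply_simps cstar_subalgebra_def)
  qed
  define G where "G = Linf (\<lambda>t. complex_of_real (F (Re (linf_apply h t))))"
  have "bounded (F ` {- norm h..norm h})"
    by (intro compact_imp_bounded compact_continuous_image F) simp
  then obtain K where K: "\<forall>s\<in>{- norm h..norm h}. norm (F s) \<le> K"
    by (auto simp: bounded_iff)
  have "bounded (range (\<lambda>t. complex_of_real (F (Re (linf_apply h t)))))"
    unfolding bounded_range_iff norm_of_real using bspec[OF K range]
    by (intro exI[of _ K]) simp
  then have G: "linf_apply G t = of_real (F (Re (linf_apply h t)))" for t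
    by (simp add: G_def Linf_inverse)
  have "G \<in> closure A"
    unfolding closure_approachable
  proof (intro allI impI)
    fix e :: real assume e: "e > 0"
    obtain p where p: "real_polynomial_function p"
      and near: "\<And>s. s \<in> {- norm h..norm h} \<Longrightarrow> \<bar>F s - p s\<bar> < e / 2"
      using Stone_Weierstrass_real_polynomial_function[OF _ F, of "e / 2"] e by auto
    obtain g where g: "g \<in> A" "\<And>t. linf_apply g t = of_real (p (Re (linf_apply h t)))"
      using poly[OF p] by blast
    have "norm (g - G) \<le> e / 2"
    proof (rule linf_normI)
      fix t
      have "cmod (linf_apply (g - G) t) = \<bar>F (Re (linf_apply h t)) - p (Re (linf_apply h t))\<bar>"
        by (simp add: linf_apply_simps g G abs_minus_commute flip: of_real_diff)
      then show "cmod (linf_apply (g - G) t) \<le> e / 2"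
        using near[OF range[of t]] by simp
    qed
    then show "\<exists>g\<in>A. dist g G < e"
      using g(1) e by (intro bexI[of _ g]) (auto simp: dist_norm)
  qed
  then have "G \<in> A"
    using A by (simp add: cstar_subalgebra_def closure_closed)
  with G show ?thesis by blast
qed

text \<open>A self-adjoint \<open>h\<close> in the unit ball is the mean of \<open>u\<close> and \<open>u\<^sup>\<star>\<close> for \<open>u = h + i\<surd>(1 - h\<^sup>2)\<close>, where
\<open>u\<^sup>\<star>u = 1\<close>. Thus \<open>\<phi>(u)\<^sup>\<star>\<phi>(u)\<close> is the projection \<open>\<phi>(1)\<close>, which bounds \<open>\<phi>(u)\<close> and so \<open>\<phi>(h)\<close>. The
C*-identity reduces an arbitrary \<open>a\<close> to the self-adjoint \<open>a\<^sup>\<star>a\<close>.\<close>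

lemma star_hom_on_linf_contractive:
  fixes A :: "'p linf set" and \<phi> :: "'p linf \<Rightarrow> 'b :: unital_cstar_algebra"
  assumes A: "cstar_subalgebra A" and one: "1 \<in> A" and \<phi>: "star_hom_on A \<phi>" and a: "a \<in> A"
  shows "norm (\<phi> a) \<le> norm a"
proof -
  have sub: "x + y \<in> A" "x * y \<in> A" "c \<cdot>\<^sub>C x \<in> A" "x\<^sup>\<star> \<in> A" if "x \<in> A" "y \<in> A" for x y c
    using A that by (auto simp: cstar_subalgebra_def)
  have hom: "\<phi> (x + y) = \<phi> x + \<phi> y" "\<phi> (x * y) = \<phi> x * \<phi> y" "\<phi> (c \<cdot>\<^sub>C x) = c \<cdot>\<^sub>C \<phi> x"
    "\<phi> (x\<^sup>\<star>) = (\<phi> x)\<^sup>\<star>" if "x \<in> A" "y \<in> A" for x y c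
    using \<phi> that by (auto simp: star_hom_on_def)
  have unit: "norm (\<phi> 1) \<le> 1"
    by (rule norm_projection_le_1)
      (simp_all add: hom(4)[OF one one, symmetric] hom(2)[OF one one, symmetric] star_one)
  have contr: "norm (\<phi> h) \<le> 1" if h: "h \<in> A" "h\<^sup>\<star> = h" "norm h \<le> 1" for h
  proof -
    have "continuous_on {- norm h..norm h} (\<lambda>s. sqrt (1 - s\<^sup>2))"
      by (intro continuous_intros)
    from linf_functional_calculus[OF A one h(1,2) this] obtain g where g: "g \<in> A"
      "\<And>t. linf_apply g t = of_real (sqrt (1 - (Re (linf_apply h t))\<^sup>2))" by blast
    define u where "u = h + \<i> \<cdot>\<^sub>C g"
    have u: "u \<in> A" "u\<^sup>\<star> \<in> A" unfolding u_def using h g by (auto intro!: sub)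
    note real = linf_self_adjoint_real[OF h(2), symmetric]
    have ustar: "u\<^sup>\<star> * u = 1"
    proof (rule linf_eqI)
      fix t
      define s where "s = Re (linf_apply h t)"
      have ht: "linf_apply h t = of_real s" using real[of t] by (simp add: s_def)
      have "\<bar>s\<bar> \<le> 1"
        using linf_le_norm[of h t] h(3) by (simp add: ht)
      then have "0 \<le> 1 - s\<^sup>2" by (simp add: abs_square_le_1)
      then show "linf_apply (u\<^sup>\<star> * u) t = linf_apply 1 t"
        by (simp add: u_def linf_apply_simps star_linf.rep_eq g(2) ht complex_eq_iff
            flip: power2_eq_square)
    qed
    have "(norm (\<phi> u))\<^sup>2 = norm (\<phi> 1)"
      using u by (simp add: cstar_identity[symmetric] hom(2,4)[symmetric] ustar)
    then have nu: "norm (\<phi> u) \<le> 1"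
      using unit by (metis abs_norm_cancel abs_square_le_1)
    have "h = (1/2) \<cdot>\<^sub>C (u + u\<^sup>\<star>)"
    proof (rule linf_eqI)
      fix t
      show "linf_apply h t = linf_apply ((1/2) \<cdot>\<^sub>C (u + u\<^sup>\<star>)) t"
        using arg_cong[OF real[of t], of Im]
        by (simp add: u_def linf_apply_simps star_linf.rep_eq g(2) complex_eq_iff)
    qed
    then have "\<phi> h = (1/2) \<cdot>\<^sub>C (\<phi> u + (\<phi> u)\<^sup>\<star>)"
      using u by (metis hom(1,3,4) sub(1))
    then have "norm (\<phi> h) = norm (\<phi> u + (\<phi> u)\<^sup>\<star>) / 2"
      by (simp add: norm_scaleC)
    also have "\<dots> \<le> 1"
      using norm_triangle_ineq[of "\<phi> u" "(\<phi> u)\<^sup>\<star>"] nu by (simp add: norm_star)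
    finally show ?thesis .
  qed
  \<comment> \<open>The scaling by \<open>r\<close> puts \<open>a\<^sup>\<star>a\<close> into the unit ball.\<close>
  define r where "r = (norm a)\<^sup>2"
  show ?thesis
  proof (cases "a = 0")
    case True
    then show ?thesis
      using hom(3)[of 0 0 0] A by (simp add: scaleC_zero_left cstar_subalgebra_def)
  next
    case False
    define h where "h = complex_of_real (inverse r) \<cdot>\<^sub>C (a\<^sup>\<star> * a)"
    have r: "r > 0" using False by (simp add: r_def)
    have aa: "a\<^sup>\<star> \<in> A" "a\<^sup>\<star> * a \<in> A"
      by (rule sub(4)[OF a a], rule sub(2)[OF sub(4)[OF a a] a])
    have "h \<in> A" unfolding h_def by (rule sub(3)[OF aa(2) aa(2)])
    moreover have "h\<^sup>\<star> = h"
      by (simp add: h_def star_scaleC star_mult star_star)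
    moreover have "norm h \<le> 1"
      using r by (simp add: h_def norm_scaleC cstar_identity norm_inverse r_def[symmetric])
    ultimately have "norm (\<phi> h) \<le> 1" by (rule contr)
    moreover have "norm (\<phi> h) = inverse r * (norm (\<phi> a))\<^sup>2"
      using r by (simp add: h_def hom(3)[OF aa(2) aa(2)] hom(2)[OF aa(1) a] hom(4)[OF a a]
          norm_scaleC norm_inverse cstar_identity)
    ultimately have "(norm (\<phi> a))\<^sup>2 \<le> (norm a)\<^sup>2"
      using r by (simp add: field_simps r_def)
    then show ?thesis by simp
  qed
qed

lemma star_hom_on_linf_continuous:
  fixes A :: "'p linf set" and \<phi> :: "'p linf \<Rightarrow> 'b :: unital_cstar_algebra"
  assumes A: "cstar_subalgebra A" and one: "1 \<in> A" and \<phi>: "star_hom_on A \<phi>"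
  shows "continuous_on A \<phi>"
proof -
  have "dist (\<phi> x) (\<phi> y) \<le> 1 * dist x y" if "x \<in> A" "y \<in> A" for x y
  proof -
    have neg: "(-1) \<cdot>\<^sub>C y \<in> A" using A that by (simp add: cstar_subalgebra_def)
    have "\<phi> (x + (-1) \<cdot>\<^sub>C y) = \<phi> x + (-1) \<cdot>\<^sub>C \<phi> y"
      using \<phi> that neg by (simp add: star_hom_on_def)
    moreover have "x + (-1) \<cdot>\<^sub>C y \<in> A"
      using A that neg by (simp add: cstar_subalgebra_def)
    ultimately show ?thesis
      using star_hom_on_linf_contractive[OF A one \<phi>, of "x + (-1) \<cdot>\<^sub>C y"]
      by (simp add: scaleC_minus_one dist_norm)
  qed
  then show ?thesis
    by (intro lipschitz_on_continuous_on[of 1] lipschitz_onI) auto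
qed


section \<open>Projections indexed by right ideals\<close>

text \<open>This is the property that the indicators \<open>1\<^sub>y\<close> and the final projections \<open>V\<^sub>yV\<^sub>y\<^sup>\<star>\<close> of a bicovariant
representation share. Idempotence is the case \<open>x = y = z\<close>.\<close>

definition ideal_projections ::
  "('p :: monoid_mult \<Rightarrow> 'a :: unital_cstar_algebra) \<Rightarrow> bool" where
  "ideal_projections q \<longleftrightarrow> q 1 = 1 \<and> (\<forall>x. (q x)\<^sup>\<star> = q x) \<and>
     (\<forall>x y z. right_ideal x \<inter> right_ideal y = right_ideal z \<longrightarrow> q x * q y = q z) \<and>
     (\<forall>x y. right_ideal x \<inter> right_ideal y = {} \<longrightarrow> q x * q y = 0)"

lemma ideal_projectionsD:
  assumes "ideal_projections q"
  shows "q 1 = 1" "(q x)\<^sup>\<star> = q x" "q x * q x = q x"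
    and "right_ideal x \<inter> right_ideal y = right_ideal z \<Longrightarrow> q x * q y = q z"
    and "right_ideal x \<inter> right_ideal y = {} \<Longrightarrow> q x * q y = 0"
  using assms by (auto simp: ideal_projections_def)

lemma self_in_right_ideal: "x \<in> right_ideal x"
  unfolding right_ideal_def by (rule range_eqI[of _ _ 1]) simp

lemma right_ideal_subset_iff: "right_ideal x \<subseteq> right_ideal y \<longleftrightarrow> x \<in> right_ideal y"
proof
  assume "x \<in> right_ideal y"
  then show "right_ideal x \<subseteq> right_ideal y"
    by (auto simp: right_ideal_def mult.assoc)
qed (use self_in_right_ideal in blast)

lemma right_ideal_Int_cases:
  assumes "left_LCM (opposite ((*) :: 'p :: monoid_mult \<Rightarrow> 'p \<Rightarrow> 'p))"
  obtains "right_ideal (x :: 'p) \<inter> right_ideal y = {}"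
    | z where "right_ideal x \<inter> right_ideal y = right_ideal z"
  using assms unfolding left_LCM_def opposite_def right_ideal_def by blast

lemma ideal_projections_commute:
  assumes lcm: "left_LCM (opposite ((*) :: 'p :: monoid_mult \<Rightarrow> 'p \<Rightarrow> 'p))"
    and q: "ideal_projections (q :: 'p \<Rightarrow> 'a :: unital_cstar_algebra)"
  shows "q x * q y = q y * q x"
  by (rule right_ideal_Int_cases[OF lcm, of x y])
    (metis ideal_projectionsD(4,5)[OF q] inf_commute)+

lemma ideal_projections_ind: "ideal_projections (ideal_ind :: 'p :: monoid_mult \<Rightarrow> _)"
  unfolding ideal_projections_def
proof (intro conjI allI impI)
  show "ideal_ind (1 :: 'p) = 1"
    by (rule linf_eqI) (simp add: ideal_ind.rep_eq right_ideal_def linf_apply_simps)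
  show "(ideal_ind x)\<^sup>\<star> = ideal_ind x" for x :: 'p
    by (rule linf_eqI) (simp add: ideal_ind.rep_eq star_linf.rep_eq)
  show "ideal_ind x * ideal_ind y = ideal_ind z"
    if "right_ideal x \<inter> right_ideal y = right_ideal z" for x y z :: 'p
    using that by (intro linf_eqI) (auto simp: ideal_ind.rep_eq linf_apply_simps)
  show "ideal_ind x * ideal_ind y = 0"
    if "right_ideal x \<inter> right_ideal y = {}" for x y :: 'p
    using that by (intro linf_eqI) (auto simp: ideal_ind.rep_eq linf_apply_simps)
qed

text \<open>Products of combinations are combinations, with coefficients that depend only on the ideals: the same
list \<open>zs\<close> serves for both families \<open>q\<close> and \<open>r\<close>. This makes the assignment of \<open>r\<close>-combinations to
\<open>q\<close>-combinations multiplicative.\<close>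

lemma ideal_projections_lin_comb_mult:
  assumes lcm: "left_LCM (opposite ((*) :: 'p :: monoid_mult \<Rightarrow> 'p \<Rightarrow> 'p))"
    and q: "ideal_projections (q :: 'p \<Rightarrow> 'a :: unital_cstar_algebra)"
    and r: "ideal_projections (r :: 'p \<Rightarrow> 'b :: unital_cstar_algebra)"
  shows "\<exists>zs. lin_comb q xs * lin_comb q ys = lin_comb q zs \<and>
    lin_comb r xs * lin_comb r ys = lin_comb r zs"
proof (induction xs)
  case Nil
  show ?case by (rule exI[of _ "[]"]) simp
next
  case (Cons v xs)
  obtain c x where v: "v = (c, x)" by (cases v)
  have "\<exists>zs. c \<cdot>\<^sub>C q x * lin_comb q ys = lin_comb q zs \<and>
    c \<cdot>\<^sub>C r x * lin_comb r ys = lin_comb r zs"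
  proof (induction ys)
    case Nil
    show ?case by (rule exI[of _ "[]"]) simp
  next
    case (Cons w ys)
    obtain d y where w: "w = (d, y)" by (cases w)
    obtain zs where zs: "c \<cdot>\<^sub>C q x * lin_comb q ys = lin_comb q zs"
      "c \<cdot>\<^sub>C r x * lin_comb r ys = lin_comb r zs" using Cons by blast
    show ?case
    proof (cases rule: right_ideal_Int_cases[OF lcm, of x y])
      case 1
      then show ?thesis
        using zs by (intro exI[of _ zs])
          (simp add: w distrib_left scaleC_mult_left scaleC_mult_right scaleC_zero_right
            ideal_projectionsD(5)[OF q] ideal_projectionsD(5)[OF r])
    next
      case (2 z)
      then show ?thesis
        using zs by (intro exI[of _ "(d * c, z) # zs"])
          (simp add: w distrib_left scaleC_mult_left scaleC_mult_right scaleC_scaleC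
            ideal_projectionsD(4)[OF q] ideal_projectionsD(4)[OF r] mult.commute)
    qed
  qed
  then obtain zs where zs: "c \<cdot>\<^sub>C q x * lin_comb q ys = lin_comb q zs"
      "c \<cdot>\<^sub>C r x * lin_comb r ys = lin_comb r zs" by blast
  obtain us where us: "lin_comb q xs * lin_comb q ys = lin_comb q us"
    "lin_comb r xs * lin_comb r ys = lin_comb r us" using Cons by blast
  show ?case
    by (rule exI[of _ "zs @ us"]) (simp add: v distrib_right zs us)
qed


section \<open>The algebra generated by the indicators of right ideals\<close>

lemma ideal_ind_in_B_alg: "ideal_ind y \<in> B_alg"
  unfolding B_alg_def by (rule hull_inc) simp

lemma cstar_subalgebra_B_alg: "cstar_subalgebra B_alg"
  unfolding B_alg_def by (rule cstar_subalgebra_hull)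

lemma one_in_B_alg: "1 \<in> (B_alg :: 'p :: monoid_mult linf set)"
  using ideal_ind_in_B_alg[of "1 :: 'p"]
  by (simp add: ideal_projectionsD(1)[OF ideal_projections_ind])

text \<open>Since \<open>1\<^sub>x1\<^sub>y\<close> is zero or again an indicator, the combinations form a \<open>\<star>\<close>-algebra already, and no
products of generators have to be added.\<close>

lemma B_alg_eq_closure_lin_comb:
  assumes lcm: "left_LCM (opposite ((*) :: 'p :: monoid_mult \<Rightarrow> 'p \<Rightarrow> 'p))"
  shows "(B_alg :: 'p linf set) = closure (range (lin_comb ideal_ind))"
proof (rule antisym)
  let ?D = "range (lin_comb ideal_ind) :: 'p linf set"
  have add: "x + y \<in> ?D" if "x \<in> ?D" "y \<in> ?D" for x y
    using that by (auto simp flip: lin_comb_simps(3))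
  have mult: "x * y \<in> ?D" if "x \<in> ?D" "y \<in> ?D" for x y
  proof -
    from that obtain xs ys where "x = lin_comb ideal_ind xs" "y = lin_comb ideal_ind ys"
      by blast
    moreover obtain zs where
      "lin_comb ideal_ind xs * lin_comb ideal_ind ys = (lin_comb ideal_ind zs :: 'p linf)"
      using ideal_projections_lin_comb_mult[OF lcm ideal_projections_ind ideal_projections_ind]
      by blast
    ultimately show ?thesis by simp
  qed
  have scale: "c \<cdot>\<^sub>C x \<in> ?D" if "x \<in> ?D" for c x
    using that by (auto simp: scaleC_lin_comb)
  have star: "x\<^sup>\<star> \<in> ?D" if "x \<in> ?D" for x
    using that by (auto simp: star_lin_comb ideal_projectionsD(2)[OF ideal_projections_ind])
  have zero: "0 \<in> ?D" by (rule range_eqI[of _ _ "[]"]) simp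
  have lim: "x \<in> closure ?D" if "\<And>n. X n \<in> ?D" "X \<longlonglongrightarrow> x" for X x
    unfolding closure_sequential using that by (intro exI[of _ X] conjI allI)
  have "cstar_subalgebra (closure ?D)"
    unfolding cstar_subalgebra_def
  proof (intro conjI ballI allI)
    show "closed (closure ?D)" by simp
    show "0 \<in> closure ?D" by (rule subsetD[OF closure_subset zero])
    fix x assume "x \<in> closure ?D"
    then obtain X where X: "\<And>n. X n \<in> ?D" "X \<longlonglongrightarrow> x"
      unfolding closure_sequential by metis
    show "c \<cdot>\<^sub>C x \<in> closure ?D" for c
      by (rule lim[OF scale[OF X(1)] tendsto_scaleC[OF X(2)]])
    show "x\<^sup>\<star> \<in> closure ?D"
      by (rule lim[OF star[OF X(1)] tendsto_star[OF X(2)]])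
    fix y assume "y \<in> closure ?D"
    then obtain Y where Y: "\<And>n. Y n \<in> ?D" "Y \<longlonglongrightarrow> y"
      unfolding closure_sequential by metis
    show "x + y \<in> closure ?D"
      by (rule lim[OF add[OF X(1) Y(1)] tendsto_add[OF X(2) Y(2)]])
    show "x * y \<in> closure ?D"
      by (rule lim[OF mult[OF X(1) Y(1)] tendsto_mult[OF X(2) Y(2)]])
  qed
  moreover have "ideal_ind y \<in> closure ?D" for y :: 'p
    by (rule subsetD[OF closure_subset], rule range_eqI[of _ _ "[(1, y)]"]) simp
  ultimately show "B_alg \<subseteq> closure ?D"
    unfolding B_alg_def by (intro hull_minimal) auto
  show "closure ?D \<subseteq> B_alg"
    using lin_comb_in_subalgebra[OF cstar_subalgebra_B_alg ideal_ind_in_B_alg]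
      cstar_subalgebra_B_alg
    by (intro closure_minimal) (auto simp: cstar_subalgebra_def)
qed

lemma B_alg_linear_eqI:
  fixes f g :: "'p :: monoid_mult linf \<Rightarrow> 'b :: unital_cstar_algebra"
  assumes lcm: "left_LCM (opposite ((*) :: 'p \<Rightarrow> 'p \<Rightarrow> 'p))"
    and cont: "continuous_on B_alg f" "continuous_on B_alg g"
    and add: "\<And>a b. a \<in> B_alg \<Longrightarrow> b \<in> B_alg \<Longrightarrow> f (a + b) = f a + f b"
      "\<And>a b. a \<in> B_alg \<Longrightarrow> b \<in> B_alg \<Longrightarrow> g (a + b) = g a + g b"
    and scale: "\<And>c a. a \<in> B_alg \<Longrightarrow> f (c \<cdot>\<^sub>C a) = c \<cdot>\<^sub>C f a"
      "\<And>c a. a \<in> B_alg \<Longrightarrow> g (c \<cdot>\<^sub>C a) = c \<cdot>\<^sub>C g a"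
    and eq: "\<And>y. f (ideal_ind y) = g (ideal_ind y)"
    and a: "a \<in> B_alg"
  shows "f a = g a"
proof -
  have "f (lin_comb ideal_ind xs) = g (lin_comb ideal_ind xs)" for xs
    using map_lin_comb[OF cstar_subalgebra_B_alg ideal_ind_in_B_alg add(1) scale(1), where xs = xs]
      map_lin_comb[OF cstar_subalgebra_B_alg ideal_ind_in_B_alg add(2) scale(2), where xs = xs]
    by (simp add: eq)
  then have "(\<lambda>a. f a - g a) ` closure (range (lin_comb ideal_ind)) \<subseteq> {0}"
    using cont by (intro image_closure_subset continuous_intros)
      (auto simp: B_alg_eq_closure_lin_comb[OF lcm])
  with a show ?thesis by (auto simp: B_alg_eq_closure_lin_comb[OF lcm])
qed


section \<open>Representing the algebra by projections on a Hilbert space\<close>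

lemma lin_comb_bop_commute:
  assumes "\<And>y. q x * q y = q y * (q x :: 'h :: complex_hilbert bop)"
  shows "q x * lin_comb q xs = lin_comb q xs * q x"
  using assms
  by (induction xs) (auto simp: distrib_left distrib_right scaleC_mult_left scaleC_mult_right)

text \<open>A combination of commuting projections is diagonal, so its norm is controlled by its eigenvalues. The
induction splits off one projection at a time: \<open>h\<close> is the orthogonal sum of its components in the range
and in the kernel of \<open>q x\<close>, both spaces are invariant under the other projections, and on the range
\<open>c \<cdot> q x\<close> acts as the scalar \<open>c\<close>. The summand \<open>d\<close> collects the scalars split off so far, and \<open>W\<close> is the
piece of the Hilbert space that has been reached.\<close>

lemma joint_eigenvector_bound:
  fixes q :: "'i \<Rightarrow> 'h :: complex_hilbert bop"
  assumes sa: "\<And>y. (q y)\<^sup>\<star> = q y" and idem: "\<And>y. q y * q y = q y"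
    and comm: "\<And>x y. q x * q y = q y * q x" and K: "0 \<le> K"
    and W: "\<And>y h. h \<in> W \<Longrightarrow> bop_apply (q y) h \<in> W \<and> h - bop_apply (q y) h \<in> W"
    and eigen: "\<And>h. h \<in> W \<Longrightarrow> h \<noteq> 0 \<Longrightarrow> (\<forall>(c, y)\<in>set xs. bop_apply (q y) h \<in> {0, h}) \<Longrightarrow>
      cmod (d + (\<Sum>(c, y)\<leftarrow>xs. if bop_apply (q y) h = h then c else 0)) \<le> K"
    and h: "h \<in> W"
  shows "norm (d \<cdot>\<^sub>C h + bop_apply (lin_comb q xs) h) \<le> K * norm h"
  using W eigen h
proof (induction xs arbitrary: W d h)
  case Nil
  show ?case
  proof (cases "h = 0")
    case False
    then have "cmod d \<le> K" using Nil.prems(2)[OF Nil.prems(3)] by simp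
    then show ?thesis
      by (simp add: bop_apply_simps norm_scaleC_hilbert mult_right_mono)
  qed (simp add: bop_apply_simps scaleC_zero_right)
next
  case (Cons v xs)
  obtain c x where v: "v = (c, x)" by (cases v)
  have q0: "bop_apply (q y) 0 = 0" and qdiff:
    "bop_apply (q y) (a - b) = bop_apply (q y) a - bop_apply (q y) b" for y a b
    using bop_linear[of "q y"] by (simp_all add: linear_simps)
  have swap: "bop_apply (q y) (bop_apply (q z) w) = bop_apply (q z) (bop_apply (q y) w)" for y z w
    using comm[of y z] by (metis times_bop.rep_eq)
  have twice: "bop_apply (q y) (bop_apply (q y) w) = bop_apply (q y) w" for y w
    using idem[of y] by (metis times_bop.rep_eq)
  let ?L = "bop_apply (lin_comb q xs)"
  have Lswap: "bop_apply (q x) (?L w) = ?L (bop_apply (q x) w)" for w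
    using lin_comb_bop_commute[of q x xs] comm by (metis times_bop.rep_eq)
  have clin: "bop_apply T (a + b) = bop_apply T a + bop_apply T b"
    "bop_apply T (e \<cdot>\<^sub>C a) = e \<cdot>\<^sub>C bop_apply T a" for T :: "'h bop" and a b e
    using bop_clinear[of T] bop_linear[of T] by (simp_all add: bounded_clinear_def linear_simps)
  define h1 where "h1 = bop_apply (q x) h"
  define h0 where "h0 = h - h1"
  have h1: "h1 \<in> W" "bop_apply (q x) h1 = h1"
    using Cons.prems(1)[OF Cons.prems(3)] by (simp_all add: h1_def twice)
  have h0: "h0 \<in> W" "bop_apply (q x) h0 = 0"
    using Cons.prems(1)[OF Cons.prems(3)] by (simp_all add: h0_def h1_def twice qdiff)
  define u1 where "u1 = (d + c) \<cdot>\<^sub>C h1 + ?L h1"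
  define u0 where "u0 = d \<cdot>\<^sub>C h0 + ?L h0"
  have n1: "norm u1 \<le> K * norm h1"
    unfolding u1_def
  proof (rule Cons.IH[of "{w \<in> W. bop_apply (q x) w = w}"])
    fix w assume w: "w \<in> {w \<in> W. bop_apply (q x) w = w}" "w \<noteq> 0"
      "\<forall>(c, y)\<in>set xs. bop_apply (q y) w \<in> {0, w}"
    then show "cmod (d + c + (\<Sum>(c, y)\<leftarrow>xs. if bop_apply (q y) w = w then c else 0)) \<le> K"
      using Cons.prems(2)[of w] by (simp add: v add.assoc)
  qed (use Cons.prems(1) h1 swap in \<open>auto simp: qdiff\<close>)
  have n0: "norm u0 \<le> K * norm h0"
    unfolding u0_def
  proof (rule Cons.IH[of "{w \<in> W. bop_apply (q x) w = 0}"])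
    fix w assume w: "w \<in> {w \<in> W. bop_apply (q x) w = 0}" "w \<noteq> 0"
      "\<forall>(c, y)\<in>set xs. bop_apply (q y) w \<in> {0, w}"
    then show "cmod (d + (\<Sum>(c, y)\<leftarrow>xs. if bop_apply (q y) w = w then c else 0)) \<le> K"
      using Cons.prems(2)[of w] by (simp add: v)
  next
    fix y w assume "w \<in> {w \<in> W. bop_apply (q x) w = 0}"
    then show "bop_apply (q y) w \<in> {w \<in> W. bop_apply (q x) w = 0} \<and>
        w - bop_apply (q y) w \<in> {w \<in> W. bop_apply (q x) w = 0}"
      using Cons.prems(1)[of w y] swap[of x y w] by (simp add: q0 qdiff)
  qed (use h0 in auto)
  have fix1: "bop_apply (q x) u1 = u1" and kill0: "bop_apply (q x) u0 = 0"
    by (simp_all add: u1_def u0_def clin Lswap h1 h0 scaleC_zero_right linear_simps[OF bop_linear])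
  have perp: "inner a b = 0" if "bop_apply (q x) a = a" "bop_apply (q x) b = 0" for a b
  proof -
    have "cinner a b = cinner a (bop_apply (q x) b)"
      using cinner_star_bop[of "q x" a b] by (simp add: sa that(1))
    also have "\<dots> = 0" by (simp add: that(2) cinner_eq scaleC_zero_right complex_eq_iff)
    finally show ?thesis by (simp add: inner_eq_Re_cinner)
  qed
  have pyth: "(norm (a + b))\<^sup>2 = (norm a)\<^sup>2 + (norm b)\<^sup>2"
    if "bop_apply (q x) a = a" "bop_apply (q x) b = 0" for a b
    by (rule norm_add_Pythagorean) (simp add: orthogonal_def perp that)
  have "(norm (u1 + u0))\<^sup>2 \<le> (K * norm h1)\<^sup>2 + (K * norm h0)\<^sup>2"
    unfolding pyth[OF fix1 kill0] using n1 n0 by (intro add_mono power_mono) simp_all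
  also have "\<dots> = (K * norm (h1 + h0))\<^sup>2"
    by (simp only: power_mult_distrib pyth[OF h1(2) h0(2)] distrib_left)
  finally have "norm (u1 + u0) \<le> K * norm (h1 + h0)"
    by (rule power2_le_imp_le) (simp add: K)
  then have "norm (u1 + u0) \<le> K * norm h" by (simp add: h0_def)
  moreover have "d \<cdot>\<^sub>C h + bop_apply (lin_comb q (v # xs)) h = u1 + u0"
  proof -
    have "h = h1 + h0" by (simp add: h0_def)
    then have "d \<cdot>\<^sub>C h + ?L h = d \<cdot>\<^sub>C h1 + ?L h1 + u0"
      by (simp add: u0_def clin scaleC_add_right)
    then show ?thesis
      by (simp add: v u1_def bop_apply_simps scaleC_add_left algebra_simps flip: h1_def)
  qed
  ultimately show ?case by simp
qed

text \<open>The projections that fix \<open>h\<close> have a nonzero product, so the LCM property gives a \<open>z\<close> for which \<open>zP\<close> is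
the intersection of their ideals, and \<open>q z\<close> still fixes \<open>h\<close>. This \<open>z\<close> is the required point: if it lay
in \<open>yP\<close> for some \<open>y\<close> with \<open>q y h = 0\<close>, then \<open>q z = q z q y\<close> would also annihilate \<open>h\<close>.\<close>

lemma joint_eigenvector_point:
  fixes q :: "'p :: monoid_mult \<Rightarrow> 'h :: complex_hilbert bop"
  assumes lcm: "left_LCM (opposite ((*) :: 'p \<Rightarrow> 'p \<Rightarrow> 'p))" and q: "ideal_projections q"
    and F: "finite F" and h: "h \<noteq> 0" and eigen: "\<forall>y\<in>F. bop_apply (q y) h \<in> {0, h}"
  shows "\<exists>t. \<forall>y\<in>F. bop_apply (q y) h = h \<longleftrightarrow> t \<in> right_ideal y"
proof -
  have q0: "bop_apply (q y) 0 = 0" for y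
    using bop_linear[of "q y"] by (simp add: linear_simps)
  have "\<exists>z. bop_apply (q z) h = h \<and> (\<forall>y\<in>F. bop_apply (q y) h = h \<longrightarrow> z \<in> right_ideal y)"
    using F
  proof induction
    case empty
    show ?case
      by (rule exI[of _ 1]) (simp add: ideal_projectionsD(1)[OF q] bop_apply_simps)
  next
    case (insert x F)
    then obtain z where z: "bop_apply (q z) h = h"
      "\<forall>y\<in>F. bop_apply (q y) h = h \<longrightarrow> z \<in> right_ideal y" by blast
    show ?case
    proof (cases "bop_apply (q x) h = h")
      case True
      then have zx: "bop_apply (q z * q x) h = h" by (simp add: times_bop.rep_eq z)
      show ?thesis
      proof (cases rule: right_ideal_Int_cases[OF lcm, of z x])
        case 1
        then show ?thesis
          using zx h ideal_projectionsD(5)[OF q 1] by (simp add: zero_bop.rep_eq)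
      next
        case (2 w)
        then have "bop_apply (q w) h = h"
          using zx ideal_projectionsD(4)[OF q 2] by simp
        moreover have "w \<in> right_ideal z" "w \<in> right_ideal x"
          using 2 self_in_right_ideal by blast+
        ultimately show ?thesis
          using z(2) right_ideal_subset_iff by blast
      qed
    qed (use z in blast)
  qed
  then obtain z where z: "bop_apply (q z) h = h"
    "\<forall>y\<in>F. bop_apply (q y) h = h \<longrightarrow> z \<in> right_ideal y" by blast
  have "bop_apply (q y) h = h" if y: "y \<in> F" "z \<in> right_ideal y" for y
  proof (rule ccontr)
    assume "bop_apply (q y) h \<noteq> h"
    then have "bop_apply (q y) h = 0" using eigen y(1) by blast
    moreover have "q z * q y = q z"
      using y(2) by (intro ideal_projectionsD(4)[OF q]) (simp add: right_ideal_subset_iff inf_absorb1)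
    ultimately have "bop_apply (q z) h = 0" by (metis times_bop.rep_eq q0)
    with z(1) h show False by simp
  qed
  with z(2) show ?thesis by blast
qed

lemma linf_apply_lin_comb_ind:
  "linf_apply (lin_comb ideal_ind xs) t = (\<Sum>(c, y)\<leftarrow>xs. if t \<in> right_ideal y then c else 0)"
  by (induction xs) (auto simp: linf_apply_simps ideal_ind.rep_eq)

lemma norm_lin_comb_le:
  fixes q :: "'p :: monoid_mult \<Rightarrow> 'h :: complex_hilbert bop"
  assumes lcm: "left_LCM (opposite ((*) :: 'p \<Rightarrow> 'p \<Rightarrow> 'p))" and q: "ideal_projections q"
  shows "norm (lin_comb q xs) \<le> norm (lin_comb ideal_ind xs :: 'p linf)"
proof (rule bop_normI)
  let ?K = "norm (lin_comb ideal_ind xs :: 'p linf)"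
  show "0 \<le> ?K" by simp
  fix h :: 'h
  have "norm (0 \<cdot>\<^sub>C h + bop_apply (lin_comb q xs) h) \<le> ?K * norm h"
  proof (rule joint_eigenvector_bound[of q _ UNIV])
    fix h :: 'h
    assume h: "h \<noteq> 0" and eigen: "\<forall>(c, y)\<in>set xs. bop_apply (q y) h \<in> {0, h}"
    then obtain t where t: "\<forall>y\<in>snd ` set xs. bop_apply (q y) h = h \<longleftrightarrow> t \<in> right_ideal y"
      using joint_eigenvector_point[OF lcm q _ h, of "snd ` set xs"] by fastforce
    have "(\<Sum>(c, y)\<leftarrow>xs. if bop_apply (q y) h = h then c else 0) =
        linf_apply (lin_comb ideal_ind xs) t"
      unfolding linf_apply_lin_comb_ind using t
      by (intro arg_cong[of _ _ sum_list] map_cong) auto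
    then show "cmod (0 + (\<Sum>(c, y)\<leftarrow>xs. if bop_apply (q y) h = h then c else 0)) \<le> ?K"
      by (simp add: linf_le_norm)
  qed (use ideal_projectionsD[OF q] ideal_projections_commute[OF lcm q] in auto)
  then show "norm (bop_apply (lin_comb q xs) h) \<le> ?K * norm h"
    by (simp add: scaleC_zero_left)
qed

text \<open>The norm inequality makes the additive relation \<open>G\<close> single-valued and uniformly continuous, so it
extends to the closure of its domain; the algebraic identities pass to limits.\<close>

lemma contractive_graph_extends:
  fixes G :: "('a :: unital_cstar_algebra \<times> 'b :: unital_cstar_algebra) set"
  assumes add: "\<And>a b a' b'. (a, b) \<in> G \<Longrightarrow> (a', b') \<in> G \<Longrightarrow> (a + a', b + b') \<in> G"
    and mult: "\<And>a b a' b'. (a, b) \<in> G \<Longrightarrow> (a', b') \<in> G \<Longrightarrow> (a * a', b * b') \<in> G"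
    and scale: "\<And>c a b. (a, b) \<in> G \<Longrightarrow> (c \<cdot>\<^sub>C a, c \<cdot>\<^sub>C b) \<in> G"
    and star: "\<And>a b. (a, b) \<in> G \<Longrightarrow> (a\<^sup>\<star>, b\<^sup>\<star>) \<in> G"
    and contr: "\<And>a b. (a, b) \<in> G \<Longrightarrow> norm b \<le> norm a"
  obtains \<phi> where "star_hom_on (closure (fst ` G)) \<phi>" "\<And>a b. (a, b) \<in> G \<Longrightarrow> \<phi> a = b"
proof -
  let ?D = "fst ` G"
  \<comment> \<open>\<open>G\<close> contains the differences of its members, by scaling with \<open>-1\<close>.\<close>
  have lip: "norm (b - b') \<le> norm (a - a')" if "(a, b) \<in> G" "(a', b') \<in> G" for a b a' b'
    using contr[OF add[OF that(1) scale[OF that(2), of "-1"]]] by (simp add: scaleC_minus_one)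
  define f where "f a = (SOME b. (a, b) \<in> G)" for a
  have f_mem: "(a, f a) \<in> G" if "a \<in> ?D" for a
    using that unfolding f_def by (auto intro: someI)
  have f_eq: "f a = b" if "(a, b) \<in> G" for a b
    using lip[OF that f_mem[of a]] that by force
  have "uniformly_continuous_on ?D f"
    using lip f_mem by (intro lipschitz_on_uniformly_continuous[of 1] lipschitz_onI)
      (simp_all add: dist_norm)
  then obtain g where "uniformly_continuous_on (closure ?D) g"
    and fg: "\<And>x. x \<in> ?D \<Longrightarrow> f x = g x"
    using uniformly_continuous_on_extension_on_closure by metis
  then have cont: "continuous_on (closure ?D) g"
    by (simp add: uniformly_continuous_imp_continuous)
  have g_eq: "g a = b" if "(a, b) \<in> G" for a b
    using f_eq[OF that] fg[of a] that by force
  have mem: "(a, g a) \<in> G" if "a \<in> ?D" for a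
    using f_mem[OF that] fg[OF that] by simp
  have lim: "(\<lambda>n. g (X n)) \<longlonglongrightarrow> g x"
    if "\<And>n. X n \<in> ?D" "X \<longlonglongrightarrow> x" for X x
  proof -
    have "X n \<in> closure ?D" for n
      by (rule subsetD[OF closure_subset that(1)])
    moreover have "x \<in> closure ?D"
      unfolding closure_sequential using that by (intro exI[of _ X] conjI allI)
    ultimately show ?thesis
      using cont that(2) unfolding continuous_on_sequentially comp_def by simp
  qed
  have lim_eq: "g x = l" if "\<And>n. (X n, Y n) \<in> G" "X \<longlonglongrightarrow> x" "Y \<longlonglongrightarrow> l" for X Y x l
  proof (rule LIMSEQ_unique[OF _ that(3)])
    have "X n \<in> ?D" for n using that(1)[of n] by force
    from lim[OF this that(2)] show "Y \<longlonglongrightarrow> g x"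
      using g_eq[OF that(1)] by simp
  qed
  have "star_hom_on (closure ?D) g"
    unfolding star_hom_on_def
  proof (intro conjI ballI allI)
    fix x assume "x \<in> closure ?D"
    then obtain X where X: "\<And>n. X n \<in> ?D" "X \<longlonglongrightarrow> x"
      unfolding closure_sequential by metis
    note gX = lim[OF X]
    show "g (c \<cdot>\<^sub>C x) = c \<cdot>\<^sub>C g x" for c
      by (rule lim_eq[OF scale[OF mem[OF X(1)]] tendsto_scaleC[OF X(2)] tendsto_scaleC[OF gX]])
    show "g (x\<^sup>\<star>) = (g x)\<^sup>\<star>"
      by (rule lim_eq[OF star[OF mem[OF X(1)]] tendsto_star[OF X(2)] tendsto_star[OF gX]])
    fix y assume "y \<in> closure ?D"
    then obtain Y where Y: "\<And>n. Y n \<in> ?D" "Y \<longlonglongrightarrow> y"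
      unfolding closure_sequential by metis
    note gY = lim[OF Y]
    show "g (x + y) = g x + g y"
      by (rule lim_eq[OF add[OF mem[OF X(1)] mem[OF Y(1)]] tendsto_add[OF X(2) Y(2)]
            tendsto_add[OF gX gY]])
    show "g (x * y) = g x * g y"
      by (rule lim_eq[OF mult[OF mem[OF X(1)] mem[OF Y(1)]] tendsto_mult[OF X(2) Y(2)]
            tendsto_mult[OF gX gY]])
  qed
  with g_eq that show ?thesis by blast
qed

lemma B_alg_representation:
  fixes q :: "'p :: monoid_mult \<Rightarrow> 'h :: complex_hilbert bop"
  assumes lcm: "left_LCM (opposite ((*) :: 'p \<Rightarrow> 'p \<Rightarrow> 'p))" and q: "ideal_projections q"
  obtains \<pi> where "star_hom_on B_alg \<pi>" "\<And>y. \<pi> (ideal_ind y) = q y"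
proof -
  let ?G = "range (\<lambda>xs. (lin_comb ideal_ind xs :: 'p linf, lin_comb q xs))"
  have mem: "(lin_comb ideal_ind xs, lin_comb q xs) \<in> ?G" for xs by blast
  obtain \<pi> where "star_hom_on (closure (fst ` ?G)) \<pi>" and \<pi>: "\<And>a b. (a, b) \<in> ?G \<Longrightarrow> \<pi> a = b"
  proof (rule contractive_graph_extends[of ?G])
    fix a b a' b' c assume ab: "(a, b) \<in> ?G"
    then obtain xs where xs: "a = lin_comb ideal_ind xs" "b = lin_comb q xs" by blast
    show "(c \<cdot>\<^sub>C a, c \<cdot>\<^sub>C b) \<in> ?G" by (simp add: xs scaleC_lin_comb)
    show "(a\<^sup>\<star>, b\<^sup>\<star>) \<in> ?G"
      by (simp add: xs star_lin_comb ideal_projectionsD(2) q ideal_projections_ind)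
    show "norm b \<le> norm a" unfolding xs by (rule norm_lin_comb_le[OF lcm q])
    assume "(a', b') \<in> ?G"
    then obtain ys where ys: "a' = lin_comb ideal_ind ys" "b' = lin_comb q ys" by blast
    show "(a + a', b + b') \<in> ?G"
      using mem[of "xs @ ys"] by (simp add: xs ys)
    show "(a * a', b * b') \<in> ?G"
      using ideal_projections_lin_comb_mult[OF lcm ideal_projections_ind q, of xs ys]
      unfolding xs ys by auto
  qed (rule that)
  moreover have "fst ` ?G = range (lin_comb ideal_ind)" by (auto simp: image_image)
  ultimately have "star_hom_on B_alg \<pi>" by (simp add: B_alg_eq_closure_lin_comb[OF lcm])
  moreover have "\<pi> (ideal_ind y) = q y" for y
    using \<pi>[OF mem[of "[(1, y)]"]] by simp
  ultimately show ?thesis using that by blast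
qed


section \<open>Bicovariance and the crossed product\<close>

lemma left_nica_iff_ideal_projections:
  assumes "piso_rep V"
  shows "left_nica V \<longleftrightarrow> ideal_projections (\<lambda>x. V x * (V x)\<^sup>\<star>)"
  using assms
  by (simp add: left_nica_def ideal_projections_def piso_rep_def star_one star_mult star_star
      mult.assoc)

lemma star_hom_on_ideal_projections:
  assumes A: "cstar_subalgebra A" and \<phi>: "star_hom_on A \<phi>" "\<phi> 1 = 1"
    and q: "ideal_projections q" "\<And>y. q y \<in> A"
  shows "ideal_projections (\<lambda>y. \<phi> (q y))"
proof -
  have mult: "\<phi> (q x) * \<phi> (q y) = \<phi> (q x * q y)" and star: "(\<phi> (q x))\<^sup>\<star> = \<phi> ((q x)\<^sup>\<star>)" for x y
    using \<phi>(1) q(2) by (simp_all add: star_hom_on_def)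
  have "0 \<in> A" using A by (simp add: cstar_subalgebra_def)
  then have "\<phi> (0 \<cdot>\<^sub>C 0) = 0 \<cdot>\<^sub>C \<phi> 0" using \<phi>(1) unfolding star_hom_on_def by blast
  then have "\<phi> 0 = 0" by (simp add: scaleC_zero_left)
  then show ?thesis
    using ideal_projectionsD[OF q(1)]
    unfolding ideal_projections_def mult star by (simp add: \<phi>(2))
qed

text \<open>Multiplication by \<open>\<phi> 1\<close> fixes every \<open>\<phi> a * b\<close>, hence by density everything, the unit included.\<close>

lemma nondegenerate_hom_one:
  assumes \<phi>: "nondegenerate_hom A \<phi>" and one: "1 \<in> A"
  shows "\<phi> 1 = 1"
proof -
  let ?E = "{x. \<phi> 1 * x = x}"
  have "\<phi> 1 * \<phi> a = \<phi> a" if "a \<in> A" for a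
    using \<phi> one that unfolding nondegenerate_hom_def star_hom_on_def by (metis mult_1_left)
  then have "{\<phi> a * b | a b. a \<in> A} \<subseteq> ?E"
    by (auto simp flip: mult.assoc)
  moreover have "subspace ?E"
    by (auto simp: subspace_def distrib_left)
  ultimately have "span {\<phi> a * b | a b. a \<in> A} \<subseteq> ?E"
    by (rule span_minimal)
  moreover have "closed ?E"
    by (intro closed_Collect_eq continuous_intros)
  ultimately have "closure (span {\<phi> a * b | a b. a \<in> A}) \<subseteq> ?E"
    by (rule closure_minimal)
  then have "1 \<in> ?E"
    using \<phi> unfolding nondegenerate_hom_def by blast
  then show ?thesis by simp
qed

lemma nondegenerate_rep_if_unital:
  assumes "star_hom_on A \<pi>" and "1 \<in> A" and "\<pi> 1 = 1"
  shows "nondegenerate_rep A \<pi>"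
proof -
  have "h \<in> {bop_apply (\<pi> a) h | a h. a \<in> A}" for h
    using assms(2,3) by (force simp: one_bop.rep_eq)
  then have "{bop_apply (\<pi> a) h | a h. a \<in> A} = UNIV" by blast
  with assms(1) show ?thesis by (simp add: nondegenerate_rep_def)
qed

text \<open>Both covariance relations are equalities of continuous linear maps on \<open>B\<^sub>P\<close>, so it suffices to check
them on the generators \<open>1\<^sub>y\<close>, where they are statements about \<open>V\<close> alone.\<close>

lemma bicovariant_covariant_pair:
  fixes V :: "'p :: monoid_mult \<Rightarrow> 'h :: complex_hilbert bop"
  assumes lcm: "left_LCM (opposite ((*) :: 'p \<Rightarrow> 'p \<Rightarrow> 'p))" and V: "bicovariant_piso_rep V"
  obtains \<pi> where "nondegenerate_rep B_alg \<pi>" "covariant_pair B_alg shift \<pi> V"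
proof -
  have rep: "V (x * y) = V x * V y" and piso: "partial_isometry (V x)"
    and nica: "nica_piso_rep V" and proj: "ideal_projections (\<lambda>x. V x * (V x)\<^sup>\<star>)" for x y
    using V left_nica_iff_ideal_projections[of V]
    by (auto simp: bicovariant_piso_rep_def nica_piso_rep_def piso_rep_def)
  obtain \<pi> where \<pi>: "star_hom_on B_alg \<pi>" and ind: "\<And>y. \<pi> (ideal_ind y) = V y * (V y)\<^sup>\<star>"
    using B_alg_representation[OF lcm proj] by blast
  have \<pi>_add: "\<pi> (a + b) = \<pi> a + \<pi> b" and \<pi>_scale: "\<pi> (c \<cdot>\<^sub>C a) = c \<cdot>\<^sub>C \<pi> a"
    if "a \<in> B_alg" "b \<in> B_alg" for a b c
    using \<pi> that by (simp_all add: star_hom_on_def)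
  have cont: "continuous_on B_alg \<pi>"
    by (rule star_hom_on_linf_continuous[OF cstar_subalgebra_B_alg one_in_B_alg \<pi>])
  note system = B_alg_system(2)[OF lcm, unfolded unital_cstar_system_def star_hom_on_def]
  have shift_mem: "shift x a \<in> B_alg" if "a \<in> B_alg" for x :: 'p and a
    using system that by blast
  have shift_add: "shift x (a + b) = shift x a + shift x b"
    and shift_scale: "shift x (c \<cdot>\<^sub>C a) = c \<cdot>\<^sub>C shift x a"
    if "a \<in> B_alg" "b \<in> B_alg" for x :: 'p and a b c
    using system that by blast+
  have covariant: "\<pi> (shift x a) = V x * \<pi> a * (V x)\<^sup>\<star>" if "a \<in> B_alg" for a x
  proof (rule B_alg_linear_eqI[OF lcm _ _ _ _ _ _ _ that])
    show "continuous_on B_alg (\<lambda>a. \<pi> (shift x a))"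
      using system by (intro continuous_on_compose2[OF cont]) auto
    show "continuous_on B_alg (\<lambda>a. V x * \<pi> a * (V x)\<^sup>\<star>)"
      by (intro continuous_intros cont)
    show "\<pi> (shift x (ideal_ind y)) = V x * \<pi> (ideal_ind y) * (V x)\<^sup>\<star>" for y
      by (simp add: B_alg_system(1)[OF lcm] ind rep star_mult mult.assoc)
  qed (simp_all add: \<pi>_add \<pi>_scale shift_add shift_scale shift_mem distrib_left distrib_right
      scaleC_mult_left scaleC_mult_right)
  have commute: "(V x)\<^sup>\<star> * V x * \<pi> a = \<pi> a * ((V x)\<^sup>\<star> * V x)" if "a \<in> B_alg" for a x
  proof (rule B_alg_linear_eqI[OF lcm _ _ _ _ _ _ _ that])
    show "(V x)\<^sup>\<star> * V x * \<pi> (ideal_ind y) = \<pi> (ideal_ind y) * ((V x)\<^sup>\<star> * V x)" for y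
      unfolding ind using piso[of "x * y"]
      by (intro partial_isometry_mult_imp_commute piso) (simp add: rep)
  qed (intro continuous_intros cont | simp add: \<pi>_add \<pi>_scale distrib_left distrib_right
      scaleC_mult_left scaleC_mult_right)+
  have "\<pi> 1 = 1"
    using ind[of 1] ideal_projectionsD(1)[OF proj]
    by (simp add: ideal_projectionsD(1)[OF ideal_projections_ind])
  then have "nondegenerate_rep B_alg \<pi>"
    by (rule nondegenerate_rep_if_unital[OF \<pi> one_in_B_alg])
  moreover have "covariant_pair B_alg shift \<pi> V"
    using \<pi> nica covariant commute by (simp add: covariant_pair_def)
  ultimately show ?thesis by (rule that)
qed

theorem proposition5p11:
  fixes i_B :: "'p :: monoid_mult linf \<Rightarrow> 'b :: unital_cstar_algebra"
    and i_P :: "'p \<Rightarrow> 'b"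
  assumes "left_LCM ((*) :: 'p \<Rightarrow> 'p \<Rightarrow> 'p)"
    and "left_LCM (opposite ((*) :: 'p \<Rightarrow> 'p \<Rightarrow> 'p))"
    and "piso_crossed_product TYPE('h :: complex_hilbert) B_alg shift i_B i_P"
  shows "bicovariant_piso_rep i_P \<and>
    cstar_subalgebra hull (range i_P) = UNIV \<and>
    (\<forall>V :: 'p \<Rightarrow> 'h bop. bicovariant_piso_rep V \<longrightarrow>
      (\<exists>\<Phi> :: 'b \<Rightarrow> 'h bop. star_hom_on UNIV \<Phi> \<and> \<Phi> 1 = 1 \<and> \<Phi> \<circ> i_P = V))"
proof (intro conjI allI impI)
  note lcm = assms(2)
  have nondeg: "nondegenerate_hom B_alg i_B" and pair: "covariant_pair B_alg shift i_B i_P"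
    and universal: "\<And>(\<pi> :: 'p linf \<Rightarrow> 'h bop) V.
      nondegenerate_rep B_alg \<pi> \<Longrightarrow> covariant_pair B_alg shift \<pi> V \<Longrightarrow>
      \<exists>\<Phi> :: 'b \<Rightarrow> 'h bop. nondegenerate_rep UNIV \<Phi> \<and> (\<forall>a\<in>B_alg. \<Phi> (i_B a) = \<pi> a) \<and> \<Phi> \<circ> i_P = V"
    and generated: "cstar_subalgebra hull {i_B a * i_P x | a x. a \<in> B_alg} = UNIV"
    using assms(3) unfolding piso_crossed_product_def by auto
  have hom: "star_hom_on B_alg i_B" and nica: "nica_piso_rep i_P"
    and cov: "\<And>a x. a \<in> B_alg \<Longrightarrow> i_B (shift x a) = i_P x * i_B a * (i_P x)\<^sup>\<star>"
    using pair by (auto simp: covariant_pair_def)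
  have one: "i_B 1 = 1"
    by (rule nondegenerate_hom_one[OF nondeg one_in_B_alg])
  have range_proj: "i_B (ideal_ind x) = i_P x * (i_P x)\<^sup>\<star>" for x
    using cov[OF one_in_B_alg, of x] B_alg_system(1)[OF lcm, of x 1] one
    by (simp add: ideal_projectionsD(1)[OF ideal_projections_ind])
  have "ideal_projections (\<lambda>x. i_B (ideal_ind x))"
    by (rule star_hom_on_ideal_projections[OF cstar_subalgebra_B_alg hom one
          ideal_projections_ind ideal_ind_in_B_alg])
  then have "left_nica i_P"
    using nica by (simp add: left_nica_iff_ideal_projections nica_piso_rep_def range_proj)
  with nica show "bicovariant_piso_rep i_P"
    by (simp add: bicovariant_piso_rep_def)

  let ?C = "cstar_subalgebra hull (range i_P)"
  have C: "cstar_subalgebra ?C" by (rule cstar_subalgebra_hull)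
  have i_P: "i_P x \<in> ?C" for x by (rule hull_inc) simp
  have "i_B (ideal_ind y) \<in> ?C" for y
    using C i_P[of y] by (simp add: range_proj cstar_subalgebra_def)
  then have "i_B (lin_comb ideal_ind xs) \<in> ?C" for xs
    using hom lin_comb_in_subalgebra[OF C, of "\<lambda>y. i_B (ideal_ind y)"]
    by (subst map_lin_comb[OF cstar_subalgebra_B_alg ideal_ind_in_B_alg])
      (simp_all add: star_hom_on_def)
  moreover have "continuous_on B_alg i_B"
    by (rule star_hom_on_linf_continuous[OF cstar_subalgebra_B_alg one_in_B_alg hom])
  ultimately have "i_B ` B_alg \<subseteq> ?C"
    using C unfolding B_alg_eq_closure_lin_comb[OF lcm]
    by (intro image_closure_subset) (auto simp: cstar_subalgebra_def)
  then have "{i_B a * i_P x | a x. a \<in> B_alg} \<subseteq> ?C"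
    using C i_P by (auto simp: cstar_subalgebra_def)
  from hull_minimal[of _ _ cstar_subalgebra, OF this C] show "?C = UNIV"
    unfolding generated by blast

  fix V :: "'p \<Rightarrow> 'h bop" assume V: "bicovariant_piso_rep V"
  obtain \<pi> where "nondegenerate_rep B_alg \<pi>" "covariant_pair B_alg shift \<pi> V"
    using bicovariant_covariant_pair[OF lcm V] by blast
  then obtain \<Phi> :: "'b \<Rightarrow> 'h bop" where \<Phi>: "nondegenerate_rep UNIV \<Phi>" "\<Phi> \<circ> i_P = V"
    using universal by blast
  have "\<Phi> 1 = \<Phi> (i_P 1)" using nica by (simp add: nica_piso_rep_def piso_rep_def)
  also have "\<dots> = V 1" using \<Phi>(2) by auto
  also have "\<dots> = 1"
    using V by (simp add: bicovariant_piso_rep_def nica_piso_rep_def piso_rep_def)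
  finally show "\<exists>\<Phi> :: 'b \<Rightarrow> 'h bop. star_hom_on UNIV \<Phi> \<and> \<Phi> 1 = 1 \<and> \<Phi> \<circ> i_P = V"
    using \<Phi> by (auto simp: nondegenerate_rep_def)
qed

end
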